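(* Let $\mathcal{H}$ be a hereditary $3$-graph property, and suppose $\mathcal{H}$ is close to some slicewise stable hereditary $3$-graph property $\mathcal{H}'$. Then $\mathcal{H}$ admits binary $\mathrm{vdisc}_3$-error.
   Context: For distinct $x,y,z$ write $xy=\{x,y\}$, $xyz=\{x,y,z\}$; $K_3[X,Y,Z]=\{xyz:x\in X,y\in Y,z\in Z\text{ pairwise distinct}\}$. A $3$-graph is a pair $H=(V,F)$ with $F\subseteq\binom V3$. A hereditary $3$-graph property is a class of finite $3$-graphs closed under isomorphism and induced sub-$3$-graphs. An equipartition is a partition whose parts differ in size by at most $1$. A $3$-graph $H=(V,F)$ is slicewise $k$-stable if there do not exist $a,b_1,\dots,b_k,c_1,\dots,c_k\in V$ such that for all $i,j\in\{1,\dots,k\}$, $\{a,b_i,c_j\}\in F$ if and only if $i\leq j$. A hereditary $3$-graph property is slicewise stable if there is $k$ such that each of its members is slicewise $k$-stable. Two $3$-graphs $(V,F),(V,F')$ on the same vertex set are $\delta$-close if $|F\Delta F'|\leq\delta|V|^3$. $\mathcal{H}$ is close to $\mathcal{H}'$ if for all $\delta>0$ there is $N$ such that every $G\in\mathcal{H}$ on at least $N$ vertices is $\delta$-close to some element of $\mathcal{H}'$ with the same vertex set. A $3$-partite $3$-graph $(U\cup V\cup W,F)$ with $|F|=d|U||V||W|$ has $\mathrm{vdisc}_3(\epsilon)$ if for all $U'\subseteq U$, $V'\subseteq V$, $W'\subseteq W$, $\big||F\cap K_3[U',V',W']|-d|U'||V'||W'|\big|\leq\epsilon|U||V||W|$.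 $\mathcal{H}$ admits binary $\mathrm{vdisc}_3$-error if for all $\epsilon>0$ and $t_0\geq1$ there are $T,N$ such that for every $H=(V,F)\in\mathcal{H}$ with $|V|\geq N$ there are an equipartition $\mathcal{P}$ of $V$ into $t$ parts, $t_0\leq t\leq T$, and a set $\Sigma\subseteq\binom{\mathcal{P}}{2}$ with $|\Sigma|\leq\epsilon t^2$ such that for every three distinct parts $X,Y,Z\in\mathcal{P}$ with $XY,YZ,XZ\notin\Sigma$, the $3$-graph $(X\cup Y\cup Z,F\cap K_3[X,Y,Z])$ has $\mathrm{vdisc}_3(\epsilon)$. *)

theory Defs
  imports Complex_Main "HOL-Library.Ramsey" "HOL-Library.Disjoint_Sets"
begin

definition three_graph :: "'a set \<Rightarrow> 'a set set \<Rightarrow> bool" where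
  "three_graph V F \<longleftrightarrow> finite V \<and> F \<subseteq> [V]\<^bsup>3\<^esup>"

definition three_graph_iso :: "'a set \<Rightarrow> 'a set set \<Rightarrow> 'b set \<Rightarrow> 'b set set \<Rightarrow> bool" where
  "three_graph_iso V F V' F' \<longleftrightarrow>
     (\<exists>f. bij_betw f V V' \<and> (\<forall>e \<in> [V]\<^bsup>3\<^esup>. e \<in> F \<longleftrightarrow> f ` e \<in> F'))"

(* A class of finite 3-graphs is represented by the set of its members (V, F) whose vertices
   lie in 'a. For infinite 'a this loses nothing, since every finite 3-graph has an isomorphic
   copy in 'a. *)
definition hereditary_property :: "('a set \<times> 'a set set) set \<Rightarrow> bool" where
  "hereditary_property \<H> \<longleftrightarrow>
     (\<forall>(V, F) \<in> \<H>. three_graph V F) \<and>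
     (\<forall>(V, F) \<in> \<H>. \<forall>V' F'. three_graph V' F' \<and> three_graph_iso V F V' F' \<longrightarrow> (V', F') \<in> \<H>) \<and>
     (\<forall>(V, F) \<in> \<H>. \<forall>V' \<subseteq> V. (V', F \<inter> [V']\<^bsup>3\<^esup>) \<in> \<H>)"

(* The vertices a, b i, c j need not be distinct; if two of a, b i, c j coincide, then
   {a, b i, c j} has fewer than three elements and so is not an edge. *)
definition slicewise_k_stable :: "nat \<Rightarrow> 'a set \<Rightarrow> 'a set set \<Rightarrow> bool" where
  "slicewise_k_stable k V F \<longleftrightarrow>
     \<not> (\<exists>a \<in> V. \<exists>b c :: nat \<Rightarrow> 'a.
          (\<forall>i \<in> {1..k}. b i \<in> V \<and> c i \<in> V) \<and>
          (\<forall>i \<in> {1..k}. \<forall>j \<in> {1..k}. {a, b i, c j} \<in> F \<longleftrightarrow> i \<le> j))"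

definition slicewise_stable :: "('a set \<times> 'a set set) set \<Rightarrow> bool" where
  "slicewise_stable \<H> \<longleftrightarrow> (\<exists>k. \<forall>(V, F) \<in> \<H>. slicewise_k_stable k V F)"

definition delta_close :: "real \<Rightarrow> 'a set \<Rightarrow> 'a set set \<Rightarrow> 'a set set \<Rightarrow> bool" where
  "delta_close \<delta> V F F' \<longleftrightarrow> real (card (sym_diff F F')) \<le> \<delta> * real (card V) ^ 3"

definition close_to :: "('a set \<times> 'a set set) set \<Rightarrow> ('a set \<times> 'a set set) set \<Rightarrow> bool" where
  "close_to \<H> \<H>' \<longleftrightarrow>
     (\<forall>\<delta> > 0. \<exists>N :: nat. \<forall>(V, F) \<in> \<H>. card V \<ge> N \<longrightarrow>
        (\<exists>F'. (V, F') \<in> \<H>' \<and> delta_close \<delta> V F F'))"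

definition K3 :: "'a set \<Rightarrow> 'a set \<Rightarrow> 'a set \<Rightarrow> 'a set set" where
  "K3 X Y Z = {{x, y, z} | x y z. x \<in> X \<and> y \<in> Y \<and> z \<in> Z \<and> x \<noteq> y \<and> y \<noteq> z \<and> x \<noteq> z}"

definition tripartite :: "'a set \<Rightarrow> 'a set \<Rightarrow> 'a set \<Rightarrow> 'a set set \<Rightarrow> bool" where
  "tripartite U V W F \<longleftrightarrow>
     finite U \<and> finite V \<and> finite W \<and> U \<inter> V = {} \<and> V \<inter> W = {} \<and> U \<inter> W = {} \<and> F \<subseteq> K3 U V W"

definition vdisc3 :: "real \<Rightarrow> 'a set \<Rightarrow> 'a set \<Rightarrow> 'a set \<Rightarrow> 'a set set \<Rightarrow> bool" where
  "vdisc3 \<epsilon> U V W F \<longleftrightarrow> tripartite U V W F \<and>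
     (\<exists>d :: real. real (card F) = d * real (card U) * real (card V) * real (card W) \<and>
        (\<forall>U' \<subseteq> U. \<forall>V' \<subseteq> V. \<forall>W' \<subseteq> W.
           \<bar>real (card (F \<inter> K3 U' V' W')) - d * real (card U') * real (card V') * real (card W')\<bar>
             \<le> \<epsilon> * real (card U) * real (card V) * real (card W)))"

definition equipartition :: "'a set \<Rightarrow> 'a set set \<Rightarrow> bool" where
  "equipartition V P \<longleftrightarrow> partition_on V P \<and> (\<forall>X \<in> P. \<forall>Y \<in> P. card X \<le> card Y + 1)"

definition binary_vdisc3_error :: "('a set \<times> 'a set set) set \<Rightarrow> bool" where
  "binary_vdisc3_error \<H> \<longleftrightarrow>
     (\<forall>\<epsilon> :: real. \<forall>t0 :: nat. \<epsilon> > 0 \<and> t0 \<ge> 1 \<longrightarrow>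
        (\<exists>T N :: nat. \<forall>(V, F) \<in> \<H>. card V \<ge> N \<longrightarrow>
           (\<exists>P \<Sigma>. equipartition V P \<and> t0 \<le> card P \<and> card P \<le> T \<and>
              \<Sigma> \<subseteq> [P]\<^bsup>2\<^esup> \<and> real (card \<Sigma>) \<le> \<epsilon> * real (card P) ^ 2 \<and>
              (\<forall>X \<in> P. \<forall>Y \<in> P. \<forall>Z \<in> P.
                 X \<noteq> Y \<and> Y \<noteq> Z \<and> X \<noteq> Z \<and> {X, Y} \<notin> \<Sigma> \<and> {Y, Z} \<notin> \<Sigma> \<and> {X, Z} \<notin> \<Sigma> \<longrightarrow>
                 vdisc3 \<epsilon> X Y Z (F \<inter> K3 X Y Z)))))"

end

theory Submission
  imports Defs
begin

text \<open>Call \<open>y\<close> and \<open>y'\<close> close for \<open>x\<close> if few \<open>z\<close> satisfy exactly one of \<open>xyz \<in> F\<close>, \<open>xy'z \<in> F\<close>. It suffices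
  to find an equipartition such that, for all but few pairs of parts \<open>(X, Y)\<close> and most \<open>x \<in> X\<close>,
  most pairs in \<open>Y\<close> are close for \<open>x\<close>, where few means much less than the size of a part: then
  \<open>F\<close> on \<open>X \<times> Y \<times> Z\<close> hardly depends on \<open>y\<close>, whatever \<open>Z\<close> is, and by symmetry it hardly depends on
  any coordinate unless one of the three pairs is bad.

  For a finite sample \<open>S\<close> of vertices, the traces of \<open>y\<close> on \<open>S\<close> in the link of \<open>x\<close> partition the
  vertices. The rows of each stable link of \<open>z \<in> S\<close> fall into boundedly many clusters, so
  one partition \<open>P\<close> nearly refines these partitions for all \<open>x\<close> simultaneously. Enlarge \<open>S\<close> to a
  sample \<open>S'\<close> that separates almost all pairs that are not close at the scale of \<open>P\<close>. By stability, each
  trace class has a bounded tree rank, and inside a class of \<open>S\<close> at most one class of \<open>S'\<close> keeps the rank.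
  So either \<open>P\<close> works, or many pairs \<open>(x, y)\<close> lose rank, which can happen only boundedly often.
  All of this uses a bound on the number of parts that does not depend on how close \<open>\<H>\<close> is to \<open>\<H>'\<close>, so
  passing from \<open>\<H>'\<close> back to \<open>\<H>\<close> only costs a small change of the densities.\<close>

section \<open>Binary trees and half graphs\<close>

text \<open>Read \<open>R\<close> as a 0/1 matrix with rows \<open>A\<close> and columns
  \<open>C\<close>. The predicate says that the Littlestone dimension (Shelah 2-rank) of the rows is
  at least \<open>d\<close>: inner nodes of a complete binary tree carry columns, and every branch
  is realised by some row.\<close>

fun full_tree :: "('b \<Rightarrow> 'c \<Rightarrow> bool) \<Rightarrow> 'c set \<Rightarrow> nat \<Rightarrow> 'b set \<Rightarrow> bool" where
  "full_tree R C 0 A \<longleftrightarrow> A \<noteq> {}"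
| "full_tree R C (Suc d) A \<longleftrightarrow>
     (\<exists>z\<in>C. full_tree R C d {y\<in>A. R y z} \<and> full_tree R C d {y\<in>A. \<not> R y z})"

lemma full_tree_mono:
  assumes "full_tree R C d A" "A \<subseteq> B" "C \<subseteq> C'"
  shows "full_tree R C' d B"
  using assms
proof (induction d arbitrary: A B)
  case (Suc d)
  then obtain z where z: "z \<in> C" "full_tree R C d {y\<in>A. R y z}" "full_tree R C d {y\<in>A. \<not> R y z}"
    by auto
  have "full_tree R C' d {y\<in>B. R y z}"
    by (rule Suc.IH[OF z(2)]) (use Suc.prems in auto)
  moreover have "full_tree R C' d {y\<in>B. \<not> R y z}"
    by (rule Suc.IH[OF z(3)]) (use Suc.prems in auto)
  ultimately show ?case using z(1) Suc.prems(3) by auto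
qed auto

lemma full_tree_nonempty: "full_tree R C d A \<Longrightarrow> A \<noteq> {}"
  by (induction d arbitrary: A) fastforce+

text \<open>A Ramsey property of trees whose nodes are coloured \<open>C1\<close> or
  \<open>C2\<close>. If the root has colour \<open>C1\<close>, either one of its two subtrees
  already contains the \<open>C2\<close> tree, or both contain a \<open>C1\<close> tree of depth
  \<open>p - 1\<close> and the root joins these. The other colour is symmetric.\<close>

lemma full_tree_Un:
  assumes "full_tree R (C1 \<union> C2) (p + q) A"
  shows "full_tree R C1 p A \<or> full_tree R C2 q A"
  using assms
proof (induction "p + q" arbitrary: p q A)
  case 0
  then show ?case by simp
next
  case (Suc n)
  show ?case
  proof (cases "p = 0 \<or> q = 0")
    case True
    then show ?thesis using full_tree_nonempty[OF Suc.prems] by auto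
  next
    case False
    then obtain p' q' where pq: "p = Suc p'" "q = Suc q'" by (metis not0_implies_Suc)
    have n: "n = p' + q" "n = p + q'" using Suc.hyps(2) pq by auto
    have "full_tree R (C1 \<union> C2) (Suc n) A" using Suc.prems Suc.hyps(2) by simp
    then obtain z where z: "z \<in> C1 \<union> C2"
      "full_tree R (C1 \<union> C2) n {y\<in>A. R y z}" "full_tree R (C1 \<union> C2) n {y\<in>A. \<not> R y z}"
      by auto
    have mono: "full_tree R C e A" if "full_tree R C e {y\<in>A. R y z} \<or> full_tree R C e {y\<in>A. \<not> R y z}"
      for C e using that by (auto elim!: full_tree_mono)
    show ?thesis
    proof (cases "z \<in> C1")
      case True
      have "full_tree R C1 p' {y\<in>A. R y z} \<or> full_tree R C2 q {y\<in>A. R y z}"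
        "full_tree R C1 p' {y\<in>A. \<not> R y z} \<or> full_tree R C2 q {y\<in>A. \<not> R y z}"
        using Suc.hyps(1)[of p' q] n(1) z by auto
      with True pq(1) mono show ?thesis by auto
    next
      case False
      have "full_tree R C1 p {y\<in>A. R y z} \<or> full_tree R C2 q' {y\<in>A. R y z}"
        "full_tree R C1 p {y\<in>A. \<not> R y z} \<or> full_tree R C2 q' {y\<in>A. \<not> R y z}"
        using Suc.hyps(1)[of p q'] n(2) z by auto
      with False z(1) pq(2) mono show ?thesis by auto
    qed
  qed
qed

text \<open>The pattern \<open>Q\<close> is a parameter because both orientations occur:
  \<open>i \<le> j\<close> and \<open>j < i\<close>.\<close>

definition half_graph :: "(nat \<Rightarrow> nat \<Rightarrow> bool) \<Rightarrow> ('b \<Rightarrow> 'c \<Rightarrow> bool) \<Rightarrow> 'b set \<Rightarrow> 'c set \<Rightarrow> nat \<Rightarrow> bool" where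
  "half_graph Q R A C p \<longleftrightarrow> (\<exists>y z. (\<forall>i<p. y i \<in> A \<and> z i \<in> C) \<and>
     (\<forall>i<p. \<forall>j<p. R (y i) (z j) \<longleftrightarrow> Q i j))"

lemma half_graph_mono:
  assumes "half_graph Q R A C p" "A \<subseteq> B" "C \<subseteq> D"
  shows "half_graph Q R B D p"
proof -
  from assms(1) obtain y z where "\<forall>i<p. y i \<in> A \<and> z i \<in> C"
    "\<forall>i<p. \<forall>j<p. R (y i) (z j) \<longleftrightarrow> Q i j" unfolding half_graph_def by auto
  with assms(2,3) show ?thesis unfolding half_graph_def
    by (intro exI[of _ y] exI[of _ z]) auto
qed

text \<open>The new pair is put in front, at index 0. Shift invariance of \<open>Q\<close> keeps the
  old relations intact, and the new row and column are constant on the old pairs, as both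
  orientations require.\<close>

lemma half_graph_Suc:
  assumes "half_graph Q R A C p" "y0 \<in> B" "z0 \<in> D" "A \<subseteq> B" "C \<subseteq> D"
    and "R y0 z0 \<longleftrightarrow> Q 0 0" "\<And>z i. z \<in> C \<Longrightarrow> R y0 z \<longleftrightarrow> Q 0 (Suc i)"
    and "\<And>y i. y \<in> A \<Longrightarrow> R y z0 \<longleftrightarrow> Q (Suc i) 0" "\<And>i j. Q (Suc i) (Suc j) = Q i j"
  shows "half_graph Q R B D (Suc p)"
proof -
  from assms(1) obtain y z where yz: "\<forall>i<p. y i \<in> A \<and> z i \<in> C"
    "\<forall>i<p. \<forall>j<p. R (y i) (z j) \<longleftrightarrow> Q i j" unfolding half_graph_def by auto
  define y' z' where "y' = case_nat y0 y" and "z' = case_nat z0 z"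
  have "\<forall>i<Suc p. y' i \<in> B \<and> z' i \<in> D"
    using yz(1) assms(2-5) by (auto simp: y'_def z'_def split: nat.split)
  moreover have "\<forall>i<Suc p. \<forall>j<Suc p. R (y' i) (z' j) \<longleftrightarrow> Q i j"
    using yz assms(6-9) by (auto simp: y'_def z'_def split: nat.split)
  ultimately show ?thesis unfolding half_graph_def by blast
qed

text \<open>Colour the nodes of a tree by their relation to one fixed leaf \<open>y0\<close>. A large monochromatic
  subtree yields the next pair of a half graph: its root \<open>z0\<close>, together with \<open>y0\<close>, and the
  recursion continues on the side of \<open>z0\<close> that disagrees with \<open>y0\<close>.\<close>

lemma full_tree_half_graph:
  "\<exists>d. \<forall>(R :: 'b \<Rightarrow> 'c \<Rightarrow> bool) C A. full_tree R C d A \<longrightarrow>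
     half_graph (\<le>) R A C p \<or> half_graph (\<lambda>i j. j < i) R A C q"
proof (induction "p + q" arbitrary: p q)
  case 0
  then show ?case by (auto simp: half_graph_def)
next
  case (Suc n)
  show ?case
  proof (cases "p = 0 \<or> q = 0")
    case True
    then show ?thesis by (auto simp: half_graph_def)
  next
    case False
    then obtain p' q' where pq: "p = Suc p'" "q = Suc q'" by (metis not0_implies_Suc)
    have n: "n = p' + q" "n = p + q'" using Suc.hyps(2) pq by auto
    from Suc.hyps(1)[OF n(1)] obtain d1 where d1: "\<And>(R :: 'b \<Rightarrow> 'c \<Rightarrow> bool) C A. full_tree R C d1 A \<Longrightarrow>
        half_graph (\<le>) R A C p' \<or> half_graph (\<lambda>i j. j < i) R A C q" by blast
    from Suc.hyps(1)[OF n(2)] obtain d2 where d2: "\<And>(R :: 'b \<Rightarrow> 'c \<Rightarrow> bool) C A. full_tree R C d2 A \<Longrightarrow>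
        half_graph (\<le>) R A C p \<or> half_graph (\<lambda>i j. j < i) R A C q'" by blast
    show ?thesis
    \<comment> \<open>In either colour one level is spent on the root \<open>z0\<close>; the
      remaining \<open>d1\<close> or \<open>d2\<close> levels feed the induction hypothesis.\<close>
    proof (intro exI[of _ "Suc d1 + Suc d2"] allI impI)
      fix R :: "'b \<Rightarrow> 'c \<Rightarrow> bool" and C A
      assume T: "full_tree R C (Suc d1 + Suc d2) A"
      obtain y0 where y0: "y0 \<in> A" using full_tree_nonempty[OF T] by auto
      have "full_tree R ({z\<in>C. R y0 z} \<union> {z\<in>C. \<not> R y0 z}) (Suc d1 + Suc d2) A"
        by (rule full_tree_mono[OF T]) auto
      from full_tree_Un[OF this]
      show "half_graph (\<le>) R A C p \<or> half_graph (\<lambda>i j. j < i) R A C q"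
      proof
        assume "full_tree R {z\<in>C. R y0 z} (Suc d1) A"
        then obtain z0 where z0: "z0 \<in> C" "R y0 z0"
          "full_tree R {z\<in>C. R y0 z} d1 {y\<in>A. \<not> R y z0}" by auto
        have "half_graph (\<le>) R {y\<in>A. \<not> R y z0} {z\<in>C. R y0 z} p' \<Longrightarrow> half_graph (\<le>) R A C (Suc p')"
          by (erule half_graph_Suc[where ?y0.0=y0 and ?z0.0=z0]) (use z0 y0 in auto)
        moreover have "half_graph (\<lambda>i j. j < i) R {y\<in>A. \<not> R y z0} {z\<in>C. R y0 z} q \<Longrightarrow>
            half_graph (\<lambda>i j. j < i) R A C q" by (erule half_graph_mono) auto
        ultimately show ?thesis using d1[OF z0(3)] pq by auto
      next
        assume "full_tree R {z\<in>C. \<not> R y0 z} (Suc d2) A"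
        then obtain z0 where z0: "z0 \<in> C" "\<not> R y0 z0"
          "full_tree R {z\<in>C. \<not> R y0 z} d2 {y\<in>A. R y z0}" by auto
        have "half_graph (\<lambda>i j. j < i) R {y\<in>A. R y z0} {z\<in>C. \<not> R y0 z} q' \<Longrightarrow>
            half_graph (\<lambda>i j. j < i) R A C (Suc q')"
          by (erule half_graph_Suc[where ?y0.0=y0 and ?z0.0=z0]) (use z0 y0 in auto)
        moreover have "half_graph (\<le>) R {y\<in>A. R y z0} {z\<in>C. \<not> R y0 z} p \<Longrightarrow>
            half_graph (\<le>) R A C p" by (erule half_graph_mono) auto
        ultimately show ?thesis using d2[OF z0(3)] pq by auto
      qed
    qed
  qed
qed

text \<open>A deep tree in a link forces a half graph of one of the two orientations, and each
  contradicts stability. The depth depends on \<open>k\<close> alone, so it serves all graphs and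
  all links at once.\<close>

lemma slicewise_k_stable_tree_bound:
  obtains d where "\<And>V (F :: 'a set set) x. slicewise_k_stable k V F \<Longrightarrow> x \<in> V \<Longrightarrow>
    \<not> full_tree (\<lambda>y z. {x, y, z} \<in> F) V d V"
proof -
  \<comment> \<open>The strict orientation needs one more index: reversing it to obtain
    \<open>i \<le> j\<close> costs one row and one column.\<close>
  from full_tree_half_graph[of k "Suc k"] obtain d
    where d: "\<forall>(R :: 'a \<Rightarrow> 'a \<Rightarrow> bool) C A. full_tree R C d A \<longrightarrow>
      half_graph (\<le>) R A C k \<or> half_graph (\<lambda>i j. j < i) R A C (Suc k)" ..
  show ?thesis
  proof (rule that[of d], rule notI)
    fix V and F :: "'a set set" and x
    assume st: "slicewise_k_stable k V F" and x: "x \<in> V"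
      and T: "full_tree (\<lambda>y z. {x, y, z} \<in> F) V d V"
    have no: False if "\<And>i. i \<in> {1..k} \<Longrightarrow> b i \<in> V \<and> c i \<in> V"
      "\<And>i j. i \<in> {1..k} \<Longrightarrow> j \<in> {1..k} \<Longrightarrow> {x, b i, c j} \<in> F \<longleftrightarrow> i \<le> j" for b c
    proof -
      have "\<exists>b c. (\<forall>i\<in>{1..k}. b i \<in> V \<and> c i \<in> V) \<and>
          (\<forall>i\<in>{1..k}. \<forall>j\<in>{1..k}. {x, b i, c j} \<in> F \<longleftrightarrow> i \<le> j)"
        by (intro exI[of _ b] exI[of _ c] conjI ballI) (use that in auto)
      with st x show False unfolding slicewise_k_stable_def by (elim notE bexI[rotated])
    qed
    from d[rule_format, OF T] show False
    proof
      assume "half_graph (\<le>) (\<lambda>y z. {x, y, z} \<in> F) V V k"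
      then obtain y z where yz: "\<forall>i<k. y i \<in> V \<and> z i \<in> V"
        "\<forall>i<k. \<forall>j<k. {x, y i, z j} \<in> F \<longleftrightarrow> i \<le> j" unfolding half_graph_def by auto
      show False by (rule no[of "\<lambda>i. y (i - 1)" "\<lambda>i. z (i - 1)"]) (use yz in auto)
    next
      assume "half_graph (\<lambda>i j. j < i) (\<lambda>y z. {x, y, z} \<in> F) V V (Suc k)"
      then obtain y z where yz: "\<forall>i<Suc k. y i \<in> V \<and> z i \<in> V"
        "\<forall>i<Suc k. \<forall>j<Suc k. {x, y i, z j} \<in> F \<longleftrightarrow> j < i" unfolding half_graph_def by auto
      \<comment> \<open>The reversal works because \<open>k - j < Suc k - i\<close> holds exactly
        when \<open>i \<le> j\<close>, for indices between 1 and \<open>k\<close>.\<close>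
      show False by (rule no[of "\<lambda>i. y (Suc k - i)" "\<lambda>j. z (k - j)"]) (use yz in auto)
    qed
  qed
qed

section \<open>Tree rank and its behaviour under splitting\<close>

text \<open>One more than the Littlestone dimension, so that the empty set has rank 0. The
  \<open>LEAST\<close> is meaningful only if some depth is excluded, hence the boundedness
  assumption in the lemmas on monotonicity and splitting.\<close>

definition tree_rank :: "('b \<Rightarrow> 'c \<Rightarrow> bool) \<Rightarrow> 'c set \<Rightarrow> 'b set \<Rightarrow> nat" where
  "tree_rank R C A = (LEAST d. \<not> full_tree R C d A)"

lemma tree_rank_le: "\<not> full_tree R C d A \<Longrightarrow> tree_rank R C A \<le> d"
  unfolding tree_rank_def by (rule Least_le)

lemma not_full_tree_rank: "\<not> full_tree R C d A \<Longrightarrow> \<not> full_tree R C (tree_rank R C A) A"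
  unfolding tree_rank_def by (rule LeastI)

lemma full_tree_below_rank: "e < tree_rank R C A \<Longrightarrow> full_tree R C e A"
  unfolding tree_rank_def using not_less_Least[of e "\<lambda>d. \<not> full_tree R C d A"] by simp

lemma tree_rank_mono:
  assumes "A \<subseteq> B" "\<not> full_tree R C d B"
  shows "tree_rank R C A \<le> tree_rank R C B"
proof (rule tree_rank_le)
  show "\<not> full_tree R C (tree_rank R C B) A"
    using not_full_tree_rank[OF assms(2)] full_tree_mono[OF _ assms(1) order_refl, of R C "tree_rank R C B"]
    by auto
qed

text \<open>If the common rank is \<open>Suc j\<close>, then \<open>A\<close> and \<open>B\<close>
  both carry trees of depth \<open>j\<close>. The column \<open>z\<close> separates them, so as a
  root it joins the two to a tree of depth \<open>Suc j\<close> in \<open>K\<close>, which the rank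
  of \<open>K\<close> excludes.\<close>

lemma tree_rank_split:
  assumes "\<not> full_tree R C d K" "A \<subseteq> K" "B \<subseteq> K" "A \<noteq> {}" "z \<in> C"
    and "\<And>y. y \<in> A \<Longrightarrow> R y z" "\<And>y. y \<in> B \<Longrightarrow> \<not> R y z"
    and "tree_rank R C A = tree_rank R C K" "tree_rank R C B = tree_rank R C K"
  shows False
proof -
  have notK: "\<not> full_tree R C (tree_rank R C K) K" using not_full_tree_rank assms(1) by blast
  have "tree_rank R C K \<noteq> 0"
  proof
    assume "tree_rank R C K = 0"
    with notK have "K = {}" by simp
    with assms show False by auto
  qed
  then obtain j where j: "tree_rank R C K = Suc j" using not0_implies_Suc by blast
  have "full_tree R C j A" "full_tree R C j B"
    by (rule full_tree_below_rank, simp only: assms(8,9) j lessI)+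
  moreover have "A \<subseteq> {y\<in>K. R y z}" "B \<subseteq> {y\<in>K. \<not> R y z}"
    using assms(2,3,6,7) by blast+
  ultimately have T1: "full_tree R C j {y\<in>K. R y z}" and T0: "full_tree R C j {y\<in>K. \<not> R y z}"
    using full_tree_mono[OF _ _ order_refl] by blast+
  have "full_tree R C (tree_rank R C K) K"
    unfolding j full_tree.simps using T1 T0 assms(5) by (intro bexI conjI)
  with notK show False by contradiction
qed


section \<open>Sampling and covering rows\<close>

lemma sum_card_swap:
  assumes "finite A" "finite B"
  shows "(\<Sum>a\<in>A. card {b\<in>B. Q a b}) = (\<Sum>b\<in>B. card {a\<in>A. Q a b})"
proof -
  have "(\<Sum>a\<in>A. card {b\<in>B. Q a b}) = (\<Sum>a\<in>A. \<Sum>b\<in>B. if Q a b then 1 else 0)"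
    by (simp only: card_eq_sum sum.inter_filter[OF assms(2)])
  also have "\<dots> = (\<Sum>b\<in>B. \<Sum>a\<in>A. if Q a b then 1 else 0)" by (rule sum.swap)
  also have "\<dots> = (\<Sum>b\<in>B. card {a\<in>A. Q a b})"
    by (simp only: card_eq_sum sum.inter_filter[OF assms(1)])
  finally show ?thesis .
qed

text \<open>A greedy substitute for random sampling: on average a vertex lies in a fraction
  \<open>r\<close> of the sets not yet hit, so some vertex reduces their number by the factor
  \<open>1 - r\<close>.\<close>

lemma greedy_hitting_set:
  fixes W :: "'e \<Rightarrow> 'v set" and r :: real
  assumes "finite V" "V \<noteq> {}" "finite I" "r \<le> 1"
    and large: "\<And>e. e \<in> I \<Longrightarrow> r * card V \<le> card {z\<in>V. z \<in> W e}"
  shows "\<exists>S\<subseteq>V. card S \<le> m \<and> card {e\<in>I. W e \<inter> S = {}} \<le> (1 - r) ^ m * card I"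
proof (induction m)
  case 0
  show ?case by (intro exI[of _ "{}"]) auto
next
  case (Suc m)
  then obtain S where S: "S \<subseteq> V" "card S \<le> m" "card {e\<in>I. W e \<inter> S = {}} \<le> (1 - r) ^ m * card I"
    by blast
  define J where "J = {e\<in>I. W e \<inter> S = {}}"
  have J: "finite J" "J \<subseteq> I" using assms(3) by (auto simp: J_def)
  \<comment> \<open>Averaging: otherwise counting the incidences between \<open>V\<close> and
    \<open>J\<close> in two ways gives a contradiction.\<close>
  have "\<exists>z\<in>V. r * card J \<le> card {e\<in>J. z \<in> W e}"
  proof (rule ccontr)
    assume "\<not> ?thesis"
    then have "(\<Sum>z\<in>V. real (card {e\<in>J. z \<in> W e})) < (\<Sum>z\<in>V. r * card J)"
      using assms(1,2) by (intro sum_strict_mono) auto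
    also have "\<dots> = (\<Sum>e\<in>J. r * card V)" by simp
    also have "\<dots> \<le> (\<Sum>e\<in>J. real (card {z\<in>V. z \<in> W e}))"
      using large J by (intro sum_mono) auto
    also have "\<dots> = (\<Sum>z\<in>V. real (card {e\<in>J. z \<in> W e}))"
      unfolding of_nat_sum[symmetric] sum_card_swap[OF J(1) assms(1), of "\<lambda>e z. z \<in> W e"] ..
    finally show False by simp
  qed
  then obtain z where z: "z \<in> V" "r * card J \<le> card {e\<in>J. z \<in> W e}" by blast
  have "{e\<in>I. W e \<inter> insert z S = {}} = J - {e\<in>J. z \<in> W e}" by (auto simp: J_def)
  then have "real (card {e\<in>I. W e \<inter> insert z S = {}}) = card J - card {e\<in>J. z \<in> W e}"
    using J(1) by (simp add: card_Diff_subset card_mono of_nat_diff)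
  also have "\<dots> \<le> card J - r * card J"
    using z(2) J(1) by (simp add: card_mono of_nat_diff)
  also have "\<dots> = (1 - r) * card J" by (simp add: algebra_simps)
  also have "\<dots> \<le> (1 - r) * ((1 - r) ^ m * card I)"
    using S(3) assms(4) unfolding J_def by (intro mult_left_mono) auto
  finally have "real (card {e\<in>I. W e \<inter> insert z S = {}}) \<le> (1 - r) ^ Suc m * card I"
    by (simp add: mult.assoc)
  moreover have "card (insert z S) \<le> Suc m"
    using S(2) finite_subset[OF S(1) assms(1)] by (simp add: card_insert_if)
  ultimately show ?case using S(1) z(1) by (intro exI[of _ "insert z S"]) auto
qed

text \<open>An analogue of the Sauer-Shelah bound. Splitting \<open>A\<close> by a column
  \<open>z\<close> leaves one half with a smaller depth bound, so the number of patterns for one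
  more column is at most the sum of the counts for depths \<open>d\<close> and
  \<open>d - 1\<close>.\<close>

lemma card_patterns_le:
  assumes "finite S" "S \<subseteq> C" "\<not> full_tree R C d A"
  shows "card ((\<lambda>y. {z\<in>S. R y z}) ` A) \<le> (card S + 1) ^ d"
  using assms
proof (induction S arbitrary: A d)
  case empty
  have "card ((\<lambda>y. {z\<in>{}. R y z}) ` A) \<le> card {{} :: 'a set}"
    by (rule card_mono) auto
  then show ?case by simp
next
  case (insert z S)
  show ?case
  proof (cases d)
    case 0
    with insert.prems show ?thesis by simp
  next
    case (Suc e)
    let ?p = "\<lambda>y. {z\<in>S. R y z}" and ?m = "card S + 1"
    let ?A1 = "{y\<in>A. R y z}" and ?A0 = "{y\<in>A. \<not> R y z}"
    have mono: "\<not> full_tree R C d ?A1" "\<not> full_tree R C d ?A0"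
      using full_tree_mono[of R C d _ A C] insert.prems(2) by auto
    \<comment> \<open>Trees of depth \<open>e\<close> in both halves would be joined by
      \<open>z\<close> to a tree of depth \<open>d\<close>.\<close>
    have one: "\<not> full_tree R C e ?A1 \<or> \<not> full_tree R C e ?A0"
      using insert.prems Suc by auto
    have bound: "card (?p ` ?A1) + card (?p ` ?A0) \<le> ?m ^ d + ?m ^ e"
      using one
    proof
      assume "\<not> full_tree R C e ?A1"
      then show ?thesis using insert.IH[of e ?A1] insert.IH[of d ?A0] mono insert.prems by auto
    next
      assume "\<not> full_tree R C e ?A0"
      then show ?thesis using insert.IH[of e ?A0] insert.IH[of d ?A1] mono insert.prems by auto
    qed
    have "(\<lambda>y. {x\<in>insert z S. R y x}) ` A \<subseteq> Set.insert z ` (?p ` ?A1) \<union> ?p ` ?A0"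
    proof (rule image_subsetI)
      fix y assume y: "y \<in> A"
      show "{x\<in>insert z S. R y x} \<in> Set.insert z ` (?p ` ?A1) \<union> ?p ` ?A0"
      proof (cases "R y z")
        case True
        then have "{x\<in>insert z S. R y x} = Set.insert z (?p y)" by auto
        with True y show ?thesis by blast
      next
        case False
        then have "{x\<in>insert z S. R y x} = ?p y" by auto
        with False y show ?thesis by blast
      qed
    qed
    moreover have fin: "finite (?p ` B)" for B
      by (rule finite_subset[of _ "Pow S"]) (use insert.hyps in auto)
    ultimately have "card ((\<lambda>y. {x\<in>insert z S. R y x}) ` A)
        \<le> card (Set.insert z ` (?p ` ?A1) \<union> ?p ` ?A0)"
      by (intro card_mono) auto
    also have "\<dots> \<le> card (?p ` ?A1) + card (?p ` ?A0)"
      using fin by (intro order_trans[OF card_Un_le] add_mono card_image_le) auto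
    also have "\<dots> \<le> ?m ^ d + ?m ^ e" by (rule bound)
    also have "\<dots> = (?m + 1) * ?m ^ e" using Suc by simp
    also have "\<dots> \<le> (?m + 1) * (?m + 1) ^ e" by (intro mult_left_mono power_mono) auto
    finally show ?thesis using Suc insert.hyps by simp
  qed
qed

lemma exp_beats_poly:
  fixes x c :: real
  assumes "0 \<le> x" "x < 1" "c > 0"
  shows "\<exists>m. x ^ m * real (m + 1) ^ e < c"
proof (cases "x = 0")
  case True
  then show ?thesis using assms by (intro exI[of _ 1]) auto
next
  case False
  \<comment> \<open>With \<open>x = y ^ Suc e\<close>, each of the \<open>e\<close> linear factors
    receives its own \<open>y ^ m\<close>, and one \<open>y ^ m\<close> is left over; it yields the
    limit 0 even when \<open>e = 0\<close>.\<close>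
  define y where "y = root (Suc e) x"
  have y: "0 < y" "y < 1" "y ^ Suc e = x"
    using assms False by (auto simp: y_def real_root_lt_1_iff simp del: power_Suc)
  have "(\<lambda>m. real m * y ^ m + y ^ m) \<longlonglongrightarrow> 0 + 0"
    using y by (intro tendsto_add powser_times_n_limit_0 LIMSEQ_realpow_zero) auto
  then have "(\<lambda>m. (real m * y ^ m + y ^ m) ^ e * y ^ m) \<longlonglongrightarrow> 0 ^ e * 0"
    using y by (intro tendsto_mult tendsto_power LIMSEQ_realpow_zero) auto
  then have "eventually (\<lambda>m. (real m * y ^ m + y ^ m) ^ e * y ^ m < c) sequentially"
    using assms(3) by (intro order_tendstoD(2)[where y = "0 ^ e * (0::real)"]) auto
  then obtain m where m: "(real m * y ^ m + y ^ m) ^ e * y ^ m < c"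
    by (meson eventually_happens trivial_limit_sequentially)
  have "real m * y ^ m + y ^ m = real (m + 1) * y ^ m" by (simp add: algebra_simps)
  moreover have "x ^ m = (y ^ m) ^ e * y ^ m"
    unfolding y(3)[symmetric] by (simp add: power_mult_distrib mult.commute flip: power_mult)
  ultimately have "x ^ m * real (m + 1) ^ e = (real m * y ^ m + y ^ m) ^ e * y ^ m"
    by (simp add: power_mult_distrib)
  with m show ?thesis by (intro exI[of _ m]) linarith
qed


text \<open>A largest set of rows that pairwise differ on more than a fraction
  \<open>\<gamma>\<close> of the columns covers all rows. Its size is bounded as in Haussler's
  packing lemma: \<open>m\<close> columns suffice to distinguish \<open>q + 1\<close> such rows, but
  bounded tree depth allows only \<open>q = (m + 1) ^ d\<close> patterns on \<open>m\<close>
  columns.\<close>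

lemma row_cover:
  fixes \<gamma> :: real
  assumes "0 < \<gamma>" "\<gamma> < 1"
  obtains q :: nat where "\<And>(R :: 'b \<Rightarrow> 'c \<Rightarrow> bool) A C. finite A \<Longrightarrow> finite C \<Longrightarrow> C \<noteq> {} \<Longrightarrow>
    \<not> full_tree R C d A \<Longrightarrow>
    \<exists>X\<subseteq>A. card X \<le> q \<and> (\<forall>y\<in>A. \<exists>x\<in>X. card {z\<in>C. R y z \<noteq> R x z} \<le> \<gamma> * card C)"
proof -
  \<comment> \<open>Among \<open>q + 1\<close> rows there are at most
    \<open>(q + 1) ^ 2 \<le> 4 * (m + 1) ^ (2 * d)\<close> ordered pairs, so this choice leaves
    fewer than one pair undistinguished.\<close>
  obtain m where m: "(1 - \<gamma>) ^ m * real (m + 1) ^ (2 * d) < 1 / 4"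
    using exp_beats_poly[of "1 - \<gamma>" "1 / 4" "2 * d"] assms by auto
  define q where "q = (m + 1) ^ d"
  have q1: "1 \<le> q" unfolding q_def by (rule one_le_power) simp
  have "(q + 1) ^ 2 \<le> (2 * q) ^ 2" using q1 by (intro power_mono) auto
  also have "\<dots> = 4 * (m + 1) ^ (2 * d)"
    by (simp add: q_def power_mult_distrib power_mult[symmetric] mult.commute[of d])
  finally have "real ((q + 1) ^ 2) \<le> real (4 * (m + 1) ^ (2 * d))" by (rule of_nat_mono)
  then have "(1 - \<gamma>) ^ m * real ((q + 1) ^ 2) \<le> (1 - \<gamma>) ^ m * real (4 * (m + 1) ^ (2 * d))"
    using assms by (intro mult_left_mono) auto
  also have "\<dots> < 1" using m by simp
  finally have small: "(1 - \<gamma>) ^ m * real ((q + 1) ^ 2) < 1" .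
  show ?thesis
  proof (rule that[of q])
    fix R :: "'b \<Rightarrow> 'c \<Rightarrow> bool" and A C
    assume fin: "finite A" "finite C" "C \<noteq> {}" and T: "\<not> full_tree R C d A"
    define sep where "sep X \<longleftrightarrow> X \<subseteq> A \<and>
      (\<forall>x\<in>X. \<forall>y\<in>X. x \<noteq> y \<longrightarrow> \<gamma> * card C < card {z\<in>C. R y z \<noteq> R x z})" for X
    have bound: "card X \<le> q" if X: "sep X" for X
    proof (rule ccontr)
      assume "\<not> card X \<le> q"
      \<comment> \<open>Exactly \<open>q + 1\<close> rows are kept, so that the number of pairs has
        a bound fixed before the sample is taken.\<close>
      then obtain Y where Y: "Y \<subseteq> X" "card Y = q + 1" "finite Y"
        using obtain_subset_with_card_n[of "q + 1" X] by auto
      define I where "I = {(x, y). x \<in> Y \<and> y \<in> Y \<and> x \<noteq> y}"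
      have I: "I \<subseteq> Y \<times> Y" "finite I"
        using Y(3) by (auto simp: I_def intro: finite_subset[of _ "Y \<times> Y"])
      have "card I \<le> (q + 1) ^ 2"
        using card_mono[OF _ I(1)] Y(2,3) by (simp add: card_cartesian_product power2_eq_square)
      define W where "W e = {z. R (snd e) z \<noteq> R (fst e) z}" for e
      have large: "\<gamma> * card C \<le> card {z\<in>C. z \<in> W e}" if "e \<in> I" for e
      proof -
        obtain x y where e: "e = (x, y)" by (cases e)
        with that Y(1) have "x \<in> X" "y \<in> X" "x \<noteq> y" by (auto simp: I_def)
        with X show ?thesis unfolding sep_def W_def e by (simp add: less_imp_le)
      qed
      have "\<exists>S\<subseteq>C. card S \<le> m \<and> card {e\<in>I. W e \<inter> S = {}} \<le> (1 - \<gamma>) ^ m * card I"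
        by (rule greedy_hitting_set[OF fin(2,3) I(2) _ large]) (use assms in simp_all)
      then obtain S where S: "S \<subseteq> C" "card S \<le> m"
        "card {e\<in>I. W e \<inter> S = {}} \<le> (1 - \<gamma>) ^ m * card I" by auto
      note S(3)
      also have "(1 - \<gamma>) ^ m * card I \<le> (1 - \<gamma>) ^ m * real ((q + 1) ^ 2)"
        using \<open>card I \<le> (q + 1) ^ 2\<close> assms by (intro mult_left_mono of_nat_mono) auto
      also note small
      finally have "{e\<in>I. W e \<inter> S = {}} = {}" using I(2) by simp
      then have hit: "W e \<inter> S \<noteq> {}" if "e \<in> I" for e using that by blast
      have inj: "inj_on (\<lambda>y. {z\<in>S. R y z}) Y"
      proof (rule inj_onI, rule ccontr)
        fix x y assume xy: "x \<in> Y" "y \<in> Y" "{z\<in>S. R x z} = {z\<in>S. R y z}" "x \<noteq> y"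
        then have "(x, y) \<in> I" by (simp add: I_def)
        from hit[OF this] obtain z where "z \<in> S" "R y z \<noteq> R x z" by (auto simp: W_def)
        with xy(3) show False by blast
      qed
      have finS: "finite S" using S(1) fin(2) by (rule finite_subset)
      have YA: "Y \<subseteq> A" using Y(1) X by (auto simp: sep_def)
      have "\<not> full_tree R C d Y" using T full_tree_mono[OF _ YA order_refl] by blast
      from card_patterns_le[OF finS S(1) this] have "card Y \<le> (card S + 1) ^ d"
        using card_image[OF inj] by simp
      also have "\<dots> \<le> q" unfolding q_def using S(2) by (intro power_mono) auto
      finally show False using Y(2) by simp
    qed
    have "sep {}" by (simp add: sep_def)
    moreover have "\<forall>X. sep X \<longrightarrow> card X < Suc q" using bound by (simp add: less_Suc_eq_le)
    ultimately obtain X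
      where X: "sep X" "\<And>Y. sep Y \<Longrightarrow> card Y \<le> card X"
      using ex_has_greatest_nat[of sep "{}" card "Suc q"] by auto
    have "\<exists>x\<in>X. card {z\<in>C. R y z \<noteq> R x z} \<le> \<gamma> * card C" if y: "y \<in> A" for y
    proof (rule ccontr)
      assume far: "\<not> ?thesis"
      have "y \<notin> X"
      proof
        assume "y \<in> X"
        moreover have "card {z\<in>C. R y z \<noteq> R y z} \<le> \<gamma> * card C" using assms by simp
        ultimately show False using far by blast
      qed
      have "sep (insert y X)"
        unfolding sep_def
      proof (intro conjI ballI impI)
        show "insert y X \<subseteq> A" using X(1) y by (simp add: sep_def)
      next
        fix u v assume uv: "u \<in> insert y X" "v \<in> insert y X" "u \<noteq> v"
        have sym: "{z\<in>C. R v z \<noteq> R u z} = {z\<in>C. R u z \<noteq> R v z}" by auto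
        consider "u \<in> X" "v \<in> X" | "u = y" "v \<in> X" | "u \<in> X" "v = y" using uv by blast
        then show "\<gamma> * card C < card {z\<in>C. R v z \<noteq> R u z}"
        proof cases
          case 1
          with X(1) uv(3) show ?thesis by (simp add: sep_def)
        next
          case 2
          with far show ?thesis unfolding sym by (simp add: not_le)
        next
          case 3
          with far show ?thesis by (simp add: not_le)
        qed
      qed
      then have "card (insert y X) \<le> card X" by (rule X(2))
      moreover have "finite X" using X(1) fin(1) by (auto simp: sep_def intro: finite_subset)
      ultimately show False using \<open>y \<notin> X\<close> by simp
    qed
    with X(1) bound[OF X(1)]
    show "\<exists>X\<subseteq>A. card X \<le> q \<and> (\<forall>y\<in>A. \<exists>x\<in>X. card {z\<in>C. R y z \<noteq> R x z} \<le> \<gamma> * card C)"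
      unfolding sep_def by blast
  qed
qed

section \<open>Equipartitions\<close>

lemma Union_consecutive_intervals:
  fixes e :: "nat \<Rightarrow> nat"
  assumes "mono e"
  shows "(\<Union>j<m. {e j..<e (Suc j)}) = {e 0..<e m}"
proof (induction m)
  case (Suc m)
  have "{e 0..<e m} \<union> {e m..<e (Suc m)} = {e 0..<e (Suc m)}"
    using monoD[OF assms, of 0 m] monoD[OF assms, of m "Suc m"] by (intro ivl_disj_un) auto
  with Suc show ?case by (simp add: lessThan_Suc Un_commute)
qed simp

text \<open>Sort the vertices by \<open>h\<close> and cut the list into \<open>t\<close> intervals
  of nearly equal length. Since \<open>h\<close> takes fewer than \<open>q + 1\<close> values, at
  most \<open>q\<close> intervals contain a jump of \<open>h\<close>; their union is
  \<open>V0\<close>.\<close>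

lemma equipartition_nearly_refining:
  fixes h :: "'b \<Rightarrow> nat"
  assumes "finite V" "0 < t" "t \<le> card V" and h: "\<And>v. v \<in> V \<Longrightarrow> h v < q"
  obtains P V0 where "equipartition V P" "card P = t" "V0 \<subseteq> V"
    "card V0 \<le> q * (card V div t + 1)"
    "\<And>Y y y'. Y \<in> P \<Longrightarrow> y \<in> Y - V0 \<Longrightarrow> y' \<in> Y - V0 \<Longrightarrow> h y = h y'"
proof -
  define n where "n = card V"
  obtain xs0 where xs0: "set xs0 = V" "distinct xs0"
    using finite_distinct_list[OF assms(1)] by blast
  define xs where "xs = sort_key h xs0"
  have xs: "set xs = V" "distinct xs" "sorted (map h xs)"
    using xs0 by (auto simp: xs_def)
  have len: "length xs = n" using distinct_card[OF xs(2)] xs(1) by (simp add: n_def)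
  have hmono: "h (xs ! i) \<le> h (xs ! j)" if "i \<le> j" "j < n" for i j
    using sorted_nth_mono[OF xs(3), of i j] that len by simp
  \<comment> \<open>Rounding down \<open>j * n / t\<close> makes all gaps equal to
    \<open>n div t\<close> or \<open>n div t + 1\<close>, which gives an equipartition
    directly.\<close>
  define e where "e j = j * n div t" for j
  have e_Suc: "e j + n div t \<le> e (Suc j)" "e (Suc j) \<le> e j + n div t + 1" for j
  proof -
    have eq: "e (Suc j) = n div t + e j + (n mod t + j * n mod t) div t"
      unfolding e_def by (simp add: div_add1_eq[of n])
    have "(n mod t + j * n mod t) div t < 2"
    proof (rule less_mult_imp_div_less)
      have "n mod t < t" "j * n mod t < t" using assms(2) by simp_all
      then show "n mod t + j * n mod t < 2 * t" by linarith
    qed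
    with eq show "e j + n div t \<le> e (Suc j)" "e (Suc j) \<le> e j + n div t + 1" by linarith+
  qed
  have e_mono: "mono e"
    using e_Suc(1) by (intro mono_iff_le_Suc[THEN iffD2]) (meson add_leE)
  have e0: "e 0 = 0" and et: "e t = n" using assms(2) by (simp_all add: e_def)
  have "0 < n div t" using assms(2,3) by (simp add: n_def div_greater_zero_iff)
  then have e_less: "e j < e (Suc j)" for j using e_Suc(1)[of j] by linarith
  have e_n: "e (Suc j) \<le> n" if "j < t" for j
    using monoD[OF e_mono, of "Suc j" t] that et by simp
  define Y where "Y j = (!) xs ` {e j..<e (Suc j)}" for j
  have inj: "inj_on ((!) xs) {..<n}"
    using xs(2) len by (auto simp: inj_on_def nth_eq_iff_index_eq)
  have card_Y: "card (Y j) = e (Suc j) - e j" if "j < t" for j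
    unfolding Y_def using e_n[OF that]
    by (subst card_image[OF inj_on_subset[OF inj]]) auto
  have Y_ne: "Y j \<noteq> {}" for j using e_less[of j] by (auto simp: Y_def)
  have Y_disj: "Y i \<inter> Y j = {}" if "i < j" "j < t" for i j
  proof -
    have "e (Suc i) \<le> e j" using monoD[OF e_mono, of "Suc i" j] that by simp
    then have disj: "{e i..<e (Suc i)} \<inter> {e j..<e (Suc j)} = {}" by auto
    have sub: "{e i..<e (Suc i)} \<subseteq> {..<n}" "{e j..<e (Suc j)} \<subseteq> {..<n}"
      using e_n[of i] e_n[of j] that by auto
    show ?thesis
      unfolding Y_def inj_on_image_Int[OF inj sub, symmetric] disj by simp
  qed
  have Y_disj': "Y i \<inter> Y j = {}" if "i \<noteq> j" "i < t" "j < t" for i j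
    using Y_disj[of i j] Y_disj[of j i] that by (cases "i < j") auto
  define P where "P = Y ` {..<t}"
  have "inj_on Y {..<t}"
    using Y_disj' Y_ne by (intro inj_onI) (metis inf.idem lessThan_iff)
  then have card_P: "card P = t" by (simp add: P_def card_image)
  have UP: "\<Union>P = V"
  proof -
    have "\<Union>P = (!) xs ` (\<Union>j<t. {e j..<e (Suc j)})" by (auto simp: P_def Y_def)
    also have "\<dots> = (!) xs ` {0..<n}"
      unfolding Union_consecutive_intervals[OF e_mono] e0 et ..
    also have "\<dots> = V" using xs(1) len by (auto simp: set_conv_nth)
    finally show ?thesis .
  qed
  have "partition_on V P"
  proof (rule partition_onI)
    show "\<Union>P = V" by (rule UP)
    show "disjnt p p'" if "p \<in> P" "p' \<in> P" "p \<noteq> p'" for p p'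
    proof -
      from that obtain i j where "i < t" "j < t" "p = Y i" "p' = Y j" by (auto simp: P_def)
      with Y_disj'[of i j] that(3) show ?thesis by (cases "i = j") (auto simp: disjnt_def)
    qed
    show "{} \<notin> P" using Y_ne by (auto simp: P_def)
  qed
  moreover have "card p \<le> card p' + 1" if "p \<in> P" "p' \<in> P" for p p'
  proof -
    from that obtain i j where "i < t" "j < t" "p = Y i" "p' = Y j" by (auto simp: P_def)
    with e_Suc(2)[of i] e_Suc(1)[of j] show ?thesis by (simp add: card_Y)
  qed
  ultimately have eq: "equipartition V P" by (auto simp: equipartition_def)

  \<comment> \<open>As \<open>h\<close> is monotone along the list, comparing the two ends of an
    interval decides whether it is constant there.\<close>
  define J where "J = {j. j < t \<and> h (xs ! e j) \<noteq> h (xs ! (e (Suc j) - 1))}"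
  define V0 where "V0 = \<Union>(Y ` J)"
  have J: "J \<subseteq> {..<t}" by (auto simp: J_def)
  then have finJ: "finite J" by (rule finite_subset) simp
  \<comment> \<open>Each interval in \<open>J\<close> ends with a larger value of \<open>h\<close>
    than every earlier interval, so distinct members of \<open>J\<close> use up distinct values
    below \<open>q\<close>.\<close>
  have "inj_on (\<lambda>j. h (xs ! (e (Suc j) - 1))) J"
  proof -
    have "h (xs ! (e (Suc i) - 1)) < h (xs ! (e (Suc j) - 1))" if "i < j" "j \<in> J" for i j
    proof -
      have jt: "j < t" using that(2) J by auto
      have "e (Suc i) \<le> e j" using monoD[OF e_mono, of "Suc i" j] that by simp
      then have "h (xs ! (e (Suc i) - 1)) \<le> h (xs ! e j)"
        using e_less[of j] e_n[OF jt] by (intro hmono) auto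
      also have "\<dots> \<le> h (xs ! (e (Suc j) - 1))"
        using e_less[of j] e_n[OF jt] by (intro hmono) auto
      finally have "h (xs ! (e (Suc i) - 1)) \<le> h (xs ! (e (Suc j) - 1))" .
      moreover have "h (xs ! e j) < h (xs ! (e (Suc j) - 1))"
        using \<open>h (xs ! e j) \<le> _\<close> that(2) by (simp add: J_def)
      ultimately show ?thesis using \<open>h (xs ! (e (Suc i) - 1)) \<le> h (xs ! e j)\<close> by linarith
    qed
    then show ?thesis by (intro linorder_inj_onI) (auto, metis less_irrefl)
  qed
  moreover have "(\<lambda>j. h (xs ! (e (Suc j) - 1))) ` J \<subseteq> {..<q}"
  proof safe
    fix j assume "j \<in> J"
    then have "j < t" by (simp add: J_def)
    then have "e (Suc j) - 1 < length xs" using e_less[of j] e_n[of j] len by linarith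
    then show "h (xs ! (e (Suc j) - 1)) < q" using h xs(1) nth_mem by blast
  qed
  ultimately have card_J: "card J \<le> q"
    using card_inj_on_le[of _ J "{..<q}"] by simp
  have "card V0 \<le> (\<Sum>j\<in>J. card (Y j))" unfolding V0_def by (rule card_UN_le[OF finJ])
  also have "\<dots> \<le> (\<Sum>j\<in>J. n div t + 1)"
  proof (rule sum_mono)
    fix j assume "j \<in> J"
    then have "card (Y j) = e (Suc j) - e j" using card_Y J by auto
    with e_Suc(2)[of j] show "card (Y j) \<le> n div t + 1" by linarith
  qed
  also have "\<dots> = card J * (n div t + 1)" by simp
  also have "\<dots> \<le> q * (n div t + 1)" using card_J by (rule mult_le_mono1)
  finally have card_V0: "card V0 \<le> q * (card V div t + 1)" by (simp add: n_def)
  have V0: "V0 \<subseteq> V" using J UP by (auto simp: V0_def P_def)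
  have const: "h y = h y'" if p: "p \<in> P" "y \<in> p - V0" "y' \<in> p - V0" for p y y'
  proof -
    from p(1) obtain j where j: "j < t" "p = Y j" by (auto simp: P_def)
    have "j \<notin> J" using j p(2) by (auto simp: V0_def)
    then have ends: "h (xs ! e j) = h (xs ! (e (Suc j) - 1))" using j(1) by (simp add: J_def)
    have "h u = h (xs ! e j)" if "u \<in> Y j" for u
    proof -
      from that obtain i where i: "e j \<le> i" "i < e (Suc j)" "u = xs ! i" by (auto simp: Y_def)
      have "h (xs ! e j) \<le> h u" using hmono[of "e j" i] i e_n[OF j(1)] by simp
      moreover have "h u \<le> h (xs ! (e (Suc j) - 1))"
        using hmono[of i "e (Suc j) - 1"] i e_n[OF j(1)] by simp
      ultimately show ?thesis using ends by simp
    qed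
    with p j(2) show ?thesis by auto
  qed
  from eq card_P V0 card_V0 const show thesis by (rule that)
qed

text \<open>A part differs from the average size by at most 1, and the average is at least 2, so a
  factor 2 absorbs the error.\<close>

lemma equipartition_card_bounds:
  assumes "equipartition V P" "finite V" "Y \<in> P" "2 * card P \<le> card V"
  shows "real (card V) \<le> 2 * card P * card Y" "real (card P) * card Y \<le> 2 * card V"
proof -
  have part: "partition_on V P" and near: "\<And>X Y. X \<in> P \<Longrightarrow> Y \<in> P \<Longrightarrow> card X \<le> card Y + 1"
    using assms(1) by (auto simp: equipartition_def)
  have finP: "finite P" using finite_elements[OF assms(2) part] .
  have V: "card V = (\<Sum>X\<in>P. card X)"
    using card_Union_disjoint[OF partition_onD2[OF part]] partition_onD1[OF part] assms(2)
    by (metis Union_upper finite_subset)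
  have "card V \<le> (\<Sum>X\<in>P. card Y + 1)" unfolding V using near assms(3) by (intro sum_mono) auto
  then have 1: "card V \<le> card P * card Y + card P" by (simp add: algebra_simps)
  have "(\<Sum>X\<in>P. card Y) \<le> (\<Sum>X\<in>P. card X + 1)" using near assms(3) by (intro sum_mono) auto
  then have 2: "card P * card Y \<le> card V + card P" unfolding V sum.distrib by simp
  have "card V \<le> 2 * (card P * card Y)" using 1 assms(4) by linarith
  then show "real (card V) \<le> 2 * card P * card Y" by (metis mult.assoc of_nat_le_iff of_nat_mult of_nat_numeral)
  have "card P * card Y \<le> 2 * card V" using 2 assms(4) by linarith
  then show "real (card P) * card Y \<le> 2 * card V" by (metis of_nat_le_iff of_nat_mult of_nat_numeral)
qed


section \<open>Refining the sample\<close>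

definition link_diff :: "'a set \<Rightarrow> 'a set set \<Rightarrow> 'a \<Rightarrow> 'a \<Rightarrow> 'a \<Rightarrow> 'a set" where
  "link_diff V F x y y' = {z\<in>V. ({x, y, z} \<in> F) \<noteq> ({x, y', z} \<in> F)}"

definition sample_class :: "'a set \<Rightarrow> 'a set set \<Rightarrow> 'a set \<Rightarrow> 'a \<Rightarrow> 'a \<Rightarrow> 'a set" where
  "sample_class V F S x y = {y'\<in>V. \<forall>z\<in>S. {x, y, z} \<in> F \<longleftrightarrow> {x, y', z} \<in> F}"

text \<open>Summed over all pairs \<open>(x, y)\<close>, this is the potential of the iteration: it
  can only fall as the sample grows.\<close>

definition class_rank :: "'a set \<Rightarrow> 'a set set \<Rightarrow> 'a set \<Rightarrow> 'a \<Rightarrow> 'a \<Rightarrow> nat" where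
  "class_rank V F S x y = tree_rank (\<lambda>y z. {x, y, z} \<in> F) V (sample_class V F S x y)"

definition unstable :: "'a set \<Rightarrow> 'a set set \<Rightarrow> 'a set \<Rightarrow> 'a set \<Rightarrow> ('a \<times> 'a) set" where
  "unstable V F S S' = {(x, y). x \<in> V \<and> y \<in> V \<and> class_rank V F S' x y \<noteq> class_rank V F S x y}"

text \<open>The threshold \<open>r\<close> will be a small constant divided by
  \<open>card P\<close>, so that a difference below \<open>r * card V\<close> is small even inside a
  single part.\<close>

definition far_triples :: "'a set \<Rightarrow> 'a set set \<Rightarrow> 'a set set \<Rightarrow> real \<Rightarrow> ('a \<times> 'a \<times> 'a) set" where
  "far_triples V F P r = {(x, y, y'). x \<in> V \<and> (\<exists>Y\<in>P. y \<in> Y \<and> y' \<in> Y) \<and>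
     r * card V \<le> card (link_diff V F x y y')}"

definition links_bounded :: "nat \<Rightarrow> 'a set \<Rightarrow> 'a set set \<Rightarrow> bool" where
  "links_bounded d V F \<longleftrightarrow> (\<forall>x\<in>V. \<not> full_tree (\<lambda>y z. {x, y, z} \<in> F) V d V)"

lemma links_bounded_subset:
  assumes "links_bounded d V F" "x \<in> V" "A \<subseteq> V"
  shows "\<not> full_tree (\<lambda>y z. {x, y, z} \<in> F) V d A"
  using assms full_tree_mono[OF _ assms(3) order_refl] unfolding links_bounded_def by blast

lemma class_rank_antimono:
  assumes "links_bounded d V F" "x \<in> V" "S \<subseteq> S'"
  shows "class_rank V F S' x y \<le> class_rank V F S x y"
  unfolding class_rank_def
proof (rule tree_rank_mono)
  show "sample_class V F S' x y \<subseteq> sample_class V F S x y"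
    using assms(3) by (auto simp: sample_class_def)
  show "\<not> full_tree (\<lambda>y z. {x, y, z} \<in> F) V d (sample_class V F S x y)"
    using assms by (intro links_bounded_subset) (auto simp: sample_class_def)
qed

lemma class_rank_le:
  assumes "links_bounded d V F" "x \<in> V"
  shows "class_rank V F S x y \<le> d"
  unfolding class_rank_def
  using assms by (intro tree_rank_le links_bounded_subset) (auto simp: sample_class_def)

text \<open>If two classes of the refined sample, separated by \<open>z\<close>, kept the rank of the class containing them,
  a root \<open>z\<close> would join their trees to a deeper one.\<close>

lemma stable_same_class:
  assumes bd: "links_bounded d V F" "x \<in> V" and S: "S' \<subseteq> V" and y: "y \<in> V" "y' \<in> V"
    and same: "y' \<in> sample_class V F S x y" and sub: "S \<subseteq> S'"
    and rk: "class_rank V F S' x y = class_rank V F S x y" "class_rank V F S' x y' = class_rank V F S x y'"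
  shows "y' \<in> sample_class V F S' x y"
proof (rule ccontr)
  assume "\<not> ?thesis"
  then obtain z where z: "z \<in> S'" "({x, y, z} \<in> F) \<noteq> ({x, y', z} \<in> F)"
    using y by (auto simp: sample_class_def)
  define K where "K = sample_class V F S x y"
  have K': "K = sample_class V F S x y'" using same by (auto simp: K_def sample_class_def)
  have tree: "\<not> full_tree (\<lambda>y z. {x, y, z} \<in> F) V d K"
    using bd by (intro links_bounded_subset) (auto simp: K_def sample_class_def)
  have split: False if "u \<in> V" "v \<in> V" "K = sample_class V F S x u" "K = sample_class V F S x v"
      "{x, u, z} \<in> F" "{x, v, z} \<notin> F"
      "class_rank V F S' x u = class_rank V F S x u" "class_rank V F S' x v = class_rank V F S x v" for u v
  proof (rule tree_rank_split[OF tree])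
    show "sample_class V F S' x u \<subseteq> K" using sub that(3) by (auto simp: sample_class_def)
    show "sample_class V F S' x v \<subseteq> K" using sub that(4) by (auto simp: sample_class_def)
    show "sample_class V F S' x u \<noteq> {}" using that(1) by (auto simp: sample_class_def)
    show "z \<in> V" using z(1) S by auto
    show "{x, w, z} \<in> F" if "w \<in> sample_class V F S' x u" for w
      using that \<open>{x, u, z} \<in> F\<close> z(1) by (auto simp: sample_class_def)
    show "{x, w, z} \<notin> F" if "w \<in> sample_class V F S' x v" for w
      using that \<open>{x, v, z} \<notin> F\<close> z(1) by (auto simp: sample_class_def)
    show "tree_rank (\<lambda>y z. {x, y, z} \<in> F) V (sample_class V F S' x u) =
        tree_rank (\<lambda>y z. {x, y, z} \<in> F) V K"
      using that(7) by (simp add: class_rank_def that(3)[symmetric])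
    show "tree_rank (\<lambda>y z. {x, y, z} \<in> F) V (sample_class V F S' x v) =
        tree_rank (\<lambda>y z. {x, y, z} \<in> F) V K"
      using that(8) by (simp add: class_rank_def that(4)[symmetric])
  qed
  show False
  proof (cases "{x, y, z} \<in> F")
    case True
    with z(2) show False using split[of y y'] y K_def K' rk by blast
  next
    case False
    with z(2) show False using split[of y' y] y K_def K' rk by blast
  qed
qed

text \<open>For \<open>z \<in> S\<close>, the test \<open>{x, y, z} \<in> F\<close> reads row
  \<open>x\<close> of the link of \<open>z\<close>. Replacing \<open>x\<close> by a cluster centre
  of that link leaves boundedly many pairs of \<open>z\<close> and a centre, independently of
  \<open>x\<close>, and \<open>P\<close> is built from the traces of \<open>y\<close> on these. The
  number \<open>t\<close> of parts is fixed first; the new sample vertices are chosen at the scale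
  \<open>\<epsilon> / t\<close>.\<close>

lemma refinement_step:
  fixes \<epsilon> :: real
  assumes "0 < \<epsilon>" "\<epsilon> < 1"
  obtains t m' N :: nat where "t0 \<le> t" "0 < t"
    "\<And>V (F :: 'a set set) S. finite V \<Longrightarrow> N \<le> card V \<Longrightarrow> links_bounded d V F \<Longrightarrow>
      S \<subseteq> V \<Longrightarrow> card S \<le> m \<Longrightarrow>
      \<exists>P S'. equipartition V P \<and> card P = t \<and> S \<subseteq> S' \<and> S' \<subseteq> V \<and> card S' \<le> m' \<and>
        t * card (far_triples V F P (\<epsilon> / t))
          \<le> (9 * \<epsilon> * (card V)\<^sup>2 + 4 * card (unstable V F S S')) * card V"
proof -
  \<comment> \<open>The clustering errors of at most \<open>m\<close> sample vertices then add up to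
    at most \<open>\<epsilon> * n\<close>; the \<open>+ 1\<close> covers
    \<open>m = 0\<close>.\<close>
  define \<gamma> where "\<gamma> = \<epsilon> / (m + 1)"
  have \<gamma>: "0 < \<gamma>" "\<gamma> < 1" "m * \<gamma> \<le> \<epsilon>"
    using assms by (auto simp: \<gamma>_def field_simps)
  obtain q where q: "\<And>(R :: 'a \<Rightarrow> 'a \<Rightarrow> bool) A C. finite A \<Longrightarrow> finite C \<Longrightarrow> C \<noteq> {} \<Longrightarrow>
      \<not> full_tree R C d A \<Longrightarrow>
      \<exists>X\<subseteq>A. card X \<le> q \<and> (\<forall>y\<in>A. \<exists>x\<in>X. card {z\<in>C. R y z \<noteq> R x z} \<le> \<gamma> * card C)"
    by (rule row_cover[OF \<gamma>(1,2), where d = d and ?'b = 'a and ?'c = 'a]) (rule that)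
  \<comment> \<open>A trace is a subset of at most \<open>m * q\<close> pairs of a sample vertex and
    a centre.\<close>
  define Q :: nat where "Q = 2 ^ (m * q)"
  \<comment> \<open>At most \<open>Q\<close> parts fail to have a constant trace, each of size at
    most \<open>2 * n / t\<close>; this \<open>t\<close> makes their union at most
    \<open>\<epsilon> * n\<close>.\<close>
  define t where "t = max (max t0 1) (nat \<lceil>2 * Q / \<epsilon>\<rceil>)"
  have t: "t0 \<le> t" "0 < t" by (auto simp: t_def)
  have "2 * Q / \<epsilon> \<le> t" unfolding t_def by linarith
  then have tQ: "2 * real Q \<le> \<epsilon> * t" using assms(1) by (simp add: field_simps)
  define r where "r = \<epsilon> / t"
  have "\<epsilon> < t" using assms(2) t(2) by linarith
  then have r: "0 < r" "r < 1" using assms(1) t(2) by (auto simp: r_def)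
  obtain m2 where m2: "(1 - r) ^ m2 < r" using real_arch_pow_inv[of r "1 - r"] r by auto
  show ?thesis
  proof (rule that[OF t, of "2 * t" "m + m2"])
    fix V and F :: "'a set set" and S
    assume fin: "finite V" and big: "2 * t \<le> card V" and bd: "links_bounded d V F"
      and S: "S \<subseteq> V" "card S \<le> m"
    define n where "n = card V"
    have Vne: "V \<noteq> {}" using big t(2) by auto
    have finS: "finite S" using S(1) fin by (rule finite_subset)
    have "\<forall>z\<in>S. \<exists>X\<subseteq>V. card X \<le> q \<and> (\<forall>x\<in>V. \<exists>x'\<in>X.
        card {y\<in>V. ({z, x, y} \<in> F) \<noteq> ({z, x', y} \<in> F)} \<le> \<gamma> * n)"
      unfolding n_def using S(1) bd by (intro ballI q[OF fin fin Vne]) (auto simp: links_bounded_def)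
    from bchoice[OF this] obtain X where X0: "\<forall>z\<in>S. X z \<subseteq> V \<and> card (X z) \<le> q \<and>
        (\<forall>x\<in>V. \<exists>x'\<in>X z. card {y\<in>V. ({z, x, y} \<in> F) \<noteq> ({z, x', y} \<in> F)} \<le> \<gamma> * n)" ..
    then have X: "\<And>z. z \<in> S \<Longrightarrow> X z \<subseteq> V" "\<And>z. z \<in> S \<Longrightarrow> card (X z) \<le> q" by auto
    define \<rho> where "\<rho> z x =
      (SOME x'. x' \<in> X z \<and> card {y\<in>V. ({z, x, y} \<in> F) \<noteq> ({z, x', y} \<in> F)} \<le> \<gamma> * n)" for z x
    have \<rho>0: "\<rho> z x \<in> X z \<and> card {y\<in>V. ({z, x, y} \<in> F) \<noteq> ({z, \<rho> z x, y} \<in> F)} \<le> \<gamma> * n"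
      if "z \<in> S" "x \<in> V" for z x
    proof -
      from X0 that have "\<exists>x'. x' \<in> X z \<and> card {y\<in>V. ({z, x, y} \<in> F) \<noteq> ({z, x', y} \<in> F)} \<le> \<gamma> * n"
        by blast
      then show ?thesis unfolding \<rho>_def by (rule someI_ex)
    qed
    then have \<rho>: "\<And>z x. z \<in> S \<Longrightarrow> x \<in> V \<Longrightarrow> \<rho> z x \<in> X z"
      "\<And>z x. z \<in> S \<Longrightarrow> x \<in> V \<Longrightarrow>
        card {y\<in>V. ({z, x, y} \<in> F) \<noteq> ({z, \<rho> z x, y} \<in> F)} \<le> \<gamma> * n" by simp_all
    define W where "W = Sigma S X"
    have finW: "finite W"
      unfolding W_def using finS X(1) fin by (intro finite_SigmaI) (auto intro: finite_subset)
    have "card W = (\<Sum>z\<in>S. card (X z))"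
      unfolding W_def using finS X(1) fin by (intro card_SigmaI) (auto intro: finite_subset)
    also have "\<dots> \<le> (\<Sum>z\<in>S. q)" using X(2) by (intro sum_mono)
    also have "\<dots> \<le> m * q" using S(2) by simp
    finally have "card (Pow W) \<le> Q"
      unfolding Q_def card_Pow[OF finW] by (intro power_increasing) auto
    obtain g where g: "bij_betw g (Pow W) {0..<card (Pow W)}"
      using ex_bij_betw_finite_nat[of "Pow W"] finW by auto
    \<comment> \<open>The trace records adjacency to all pairs in \<open>W\<close>, not only those
      for one \<open>x\<close>, so a single partition serves every \<open>x\<close>.\<close>
    define tr where "tr y = {(z, x)\<in>W. {z, x, y} \<in> F}" for y
    have tr: "tr y \<in> Pow W" for y by (auto simp: tr_def)
    define h where "h y = g (tr y)" for y
    have hQ: "h v < Q" for v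
    proof -
      have "h v \<in> {0..<card (Pow W)}" unfolding h_def using bij_betwE[OF g] tr by blast
      with \<open>card (Pow W) \<le> Q\<close> show ?thesis by simp
    qed
    have tV: "t \<le> card V" using big by simp
    obtain P V0 where P: "equipartition V P" "card P = t" "V0 \<subseteq> V"
      "card V0 \<le> Q * (card V div t + 1)"
      "\<And>Y y y'. Y \<in> P \<Longrightarrow> y \<in> Y - V0 \<Longrightarrow> y' \<in> Y - V0 \<Longrightarrow> h y = h y'"
      by (rule equipartition_nearly_refining[where h = h, OF fin t(2) tV hQ]) (rule that)
    have part: "partition_on V P" using P(1) by (simp add: equipartition_def)
    have V0: "card V0 \<le> \<epsilon> * n"
    proof -
      have "real (n div t) \<le> n / t" by (rule of_nat_div_le_of_nat)
      moreover have "1 \<le> n / t" using tV t(2) by (simp add: n_def)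
      ultimately have "real (n div t + 1) \<le> 2 * n / t" by simp
      then have "Q * real (n div t + 1) \<le> Q * (2 * n / t)" by (rule mult_left_mono) simp
      moreover have "real (card V0) \<le> real (Q * (n div t + 1))"
        using P(4) unfolding n_def by (rule of_nat_mono)
      ultimately have "real (card V0) \<le> Q * (2 * n / t)" unfolding of_nat_mult by linarith
      also have "\<dots> = (2 * real Q) * real n / t" by simp
      also have "\<dots> \<le> (\<epsilon> * t) * real n / t" using tQ by (intro divide_right_mono mult_right_mono) auto
      also have "\<dots> = \<epsilon> * n" using t(2) by simp
      finally show ?thesis by simp
    qed
    \<comment> \<open>The vertices \<open>y\<close> for which moving \<open>x\<close> to its centre
      changes the answer at some \<open>z \<in> S\<close>.\<close>
    define G where "G x = (\<Union>z\<in>S. {y\<in>V. ({z, x, y} \<in> F) \<noteq> ({z, \<rho> z x, y} \<in> F)})" for x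
    have G: "card (G x) \<le> \<epsilon> * n" if "x \<in> V" for x
    proof -
      have "real (card (G x)) \<le> (\<Sum>z\<in>S. real (card {y\<in>V. ({z, x, y} \<in> F) \<noteq> ({z, \<rho> z x, y} \<in> F)}))"
        unfolding G_def of_nat_sum[symmetric] of_nat_le_iff by (rule card_UN_le[OF finS])
      also have "\<dots> \<le> (\<Sum>z\<in>S. \<gamma> * n)" using \<rho>(2) that by (intro sum_mono) auto
      also have "\<dots> = (card S * \<gamma>) * n" by simp
      also have "\<dots> \<le> (m * \<gamma>) * n" using S(2) \<gamma>(1) by (intro mult_right_mono) auto
      also have "\<dots> \<le> \<epsilon> * n" using \<gamma>(3) by (intro mult_right_mono) auto
      finally show ?thesis .
    qed
    define I where "I = {(x, y, y') \<in> V \<times> V \<times> V. r * n \<le> card (link_diff V F x y y')}"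
    define L where "L e = (case e of (x, y, y') \<Rightarrow> link_diff V F x y y')" for e
    have I: "I \<subseteq> V \<times> V \<times> V" "finite I"
      using fin by (auto simp: I_def intro: finite_subset[of _ "V \<times> V \<times> V"])
    have "card I \<le> n ^ 3"
      using card_mono[OF _ I(1)] fin by (simp add: card_cartesian_product n_def power3_eq_cube)
    have large: "r * card V \<le> card {z\<in>V. z \<in> L e}" if e: "e \<in> I" for e
    proof -
      obtain x y y' where eq: "e = (x, y, y')" by (cases e)
      have "{z\<in>V. z \<in> L e} = link_diff V F x y y'" by (auto simp: L_def eq link_diff_def)
      with e show ?thesis by (simp add: eq I_def n_def)
    qed
    have "\<exists>S\<subseteq>V. card S \<le> m2 \<and> card {e\<in>I. L e \<inter> S = {}} \<le> (1 - r) ^ m2 * card I"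
      by (rule greedy_hitting_set[OF fin Vne I(2) _ large]) (use r in simp_all)
    then obtain S2 where S2: "S2 \<subseteq> V" "card S2 \<le> m2"
      "card {e\<in>I. L e \<inter> S2 = {}} \<le> (1 - r) ^ m2 * card I" by blast
    define S' where "S' = S \<union> S2"
    have S': "S \<subseteq> S'" "S' \<subseteq> V" "card S' \<le> m + m2"
      using S S2(1,2) card_Un_le[of S S2] by (auto simp: S'_def)
    define U where "U x = {y. (x, y) \<in> unstable V F S S'}" for x
    define B where "B x = V0 \<union> G x \<union> U x" for x
    have BV: "B x \<subseteq> V" for x using P(3) by (auto simp: B_def G_def U_def unstable_def)
    have finB: "finite (B x)" for x using BV fin by (rule finite_subset)
    \<comment> \<open>Exceptional pairs \<open>(x, y)\<close> together with a vertex in the part of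
      \<open>y\<close>. Parts have at most \<open>2 * n / t\<close> vertices, which supplies the
      factor \<open>1 / t\<close> in the final count.\<close>
    define D where "D = Sigma (Sigma V B) (\<lambda>(x, y). {y'. \<exists>Y\<in>P. y \<in> Y \<and> y' \<in> Y})"
    have fin_part: "finite {y'. \<exists>Y\<in>P. y \<in> Y \<and> y' \<in> Y}" for y
      using partition_onD1[OF part] fin by (auto intro: finite_subset[of _ V])
    have card_part: "t * real (card {y'. \<exists>Y\<in>P. y \<in> Y \<and> y' \<in> Y}) \<le> 2 * n" for y
    proof (cases "\<exists>Y\<in>P. y \<in> Y")
      case True
      then obtain Y where Y: "Y \<in> P" "y \<in> Y" by blast
      have "{y'. \<exists>Y\<in>P. y \<in> Y \<and> y' \<in> Y} = Y"
        using Y partition_onD2[OF part] by (auto simp: pairwise_def disjnt_def)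
      with equipartition_card_bounds(2)[OF P(1) fin Y(1)] big P(2) show ?thesis
        by (simp add: n_def)
    qed auto
    have finD: "finite D"
      unfolding D_def using fin finB fin_part by (intro finite_SigmaI) auto
    have "card D = (\<Sum>(x, y)\<in>Sigma V B. card {y'. \<exists>Y\<in>P. y \<in> Y \<and> y' \<in> Y})"
      unfolding D_def using fin finB fin_part by (subst card_SigmaI) (auto intro!: sum.cong)
    then have "t * real (card D) = (\<Sum>(x, y)\<in>Sigma V B. t * real (card {y'. \<exists>Y\<in>P. y \<in> Y \<and> y' \<in> Y}))"
      by (simp add: sum_distrib_left case_prod_unfold)
    also have "\<dots> \<le> (\<Sum>e\<in>Sigma V B. 2 * real n)"
      using card_part by (intro sum_mono) (simp add: case_prod_unfold)
    also have "\<dots> = 2 * n * real (card (Sigma V B))" by simp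
    finally have D1: "t * real (card D) \<le> 2 * n * real (card (Sigma V B))" .
    have "Sigma V U = unstable V F S S'" by (auto simp: U_def unstable_def)
    moreover have "card (Sigma V U) = (\<Sum>x\<in>V. card (U x))"
      using fin by (intro card_SigmaI) (auto simp: U_def unstable_def intro: finite_subset[of _ V])
    ultimately have U: "(\<Sum>x\<in>V. real (card (U x))) = card (unstable V F S S')" by simp
    have "real (card (Sigma V B)) = (\<Sum>x\<in>V. real (card (B x)))"
      using fin finB by (subst card_SigmaI) auto
    also have "\<dots> \<le> (\<Sum>x\<in>V. 2 * \<epsilon> * n + real (card (U x)))"
    proof (rule sum_mono)
      fix x assume x: "x \<in> V"
      have "card (B x) \<le> card V0 + card (G x) + card (U x)"
        unfolding B_def by (intro order_trans[OF card_Un_le] add_mono card_Un_le order_refl)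
      with V0 G[OF x] show "real (card (B x)) \<le> 2 * \<epsilon> * n + real (card (U x))" by linarith
    qed
    also have "\<dots> = 2 * \<epsilon> * (n * n) + card (unstable V F S S')"
      by (simp add: sum.distrib U n_def)
    finally have "2 * n * real (card (Sigma V B))
        \<le> 2 * n * (2 * \<epsilon> * (n * n) + card (unstable V F S S'))"
      by (intro mult_left_mono) auto
    with D1 have D: "t * real (card D) \<le> 2 * n * (2 * \<epsilon> * (n * n) + card (unstable V F S S'))"
      by linarith
    \<comment> \<open>Either of the two vertices in a far triple may be the exceptional one, hence
      the union of both orders.\<close>
    define D' where "D' = (\<lambda>((x, y), y'). (x, y, y')) ` D \<union> (\<lambda>((x, y), y'). (x, y', y)) ` D"
    have finD': "finite D'" using finD by (simp add: D'_def)
    have D': "card D' \<le> 2 * card D"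
      unfolding D'_def mult_2 by (intro order_trans[OF card_Un_le] add_mono card_image_le finD)
    have cover: "far_triples V F P r \<subseteq> {e\<in>I. L e \<inter> S2 = {}} \<union> D'"
    proof
      fix e assume e: "e \<in> far_triples V F P r"
      then obtain x y y' Y where eq: "e = (x, y, y')" and x: "x \<in> V" and Y: "Y \<in> P" "y \<in> Y" "y' \<in> Y"
        and far: "r * n \<le> card (link_diff V F x y y')"
        by (auto simp: far_triples_def n_def)
      have yV: "y \<in> V" "y' \<in> V" using Y partition_onD1[OF part] by auto
      show "e \<in> {e\<in>I. L e \<inter> S2 = {}} \<union> D'"
      proof (cases "y \<in> B x \<or> y' \<in> B x")
        case True
        then have "((x, y), y') \<in> D \<or> ((x, y'), y) \<in> D" using x Y by (auto simp: D_def)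
        then have "e \<in> D'" unfolding D'_def eq by force
        then show ?thesis ..
      next
        case False
        then have nB: "y \<notin> V0" "y' \<notin> V0" "y \<notin> G x" "y' \<notin> G x" "y \<notin> U x" "y' \<notin> U x"
          by (auto simp: B_def)
        have "h y = h y'" using P(5)[OF Y(1)] Y nB by blast
        then have "tr y = tr y'"
          unfolding h_def using inj_onD[OF bij_betw_imp_inj_on[OF g] _ tr tr] by blast
        have "{x, y, z} \<in> F \<longleftrightarrow> {x, y', z} \<in> F" if z: "z \<in> S" for z
        proof -
          have W: "(z, \<rho> z x) \<in> W" using z x \<rho>(1) by (auto simp: W_def)
          \<comment> \<open>Outside \<open>G x\<close> the vertex \<open>x\<close> may be exchanged
            for its centre, at \<open>y\<close> and at \<open>y'\<close>; the common trace compares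
            the two there.\<close>
          have "{z, x, y} \<in> F \<longleftrightarrow> {z, \<rho> z x, y} \<in> F" using nB(3) z yV by (auto simp: G_def)
          also have "\<dots> \<longleftrightarrow> (z, \<rho> z x) \<in> tr y" using W by (simp add: tr_def)
          also have "\<dots> \<longleftrightarrow> (z, \<rho> z x) \<in> tr y'" using \<open>tr y = tr y'\<close> by simp
          also have "\<dots> \<longleftrightarrow> {z, \<rho> z x, y'} \<in> F" using W by (simp add: tr_def)
          also have "\<dots> \<longleftrightarrow> {z, x, y'} \<in> F" using nB(4) z yV by (auto simp: G_def)
          finally show ?thesis by (simp add: insert_commute)
        qed
        then have "y' \<in> sample_class V F S x y" using yV by (simp add: sample_class_def)
        then have "y' \<in> sample_class V F S' x y"
          using nB(5,6) x yV by (intro stable_same_class[OF bd x S'(2) yV _ S'(1)])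
            (auto simp: U_def unstable_def)
        then have "link_diff V F x y y' \<inter> S2 = {}"
          by (auto simp: sample_class_def link_diff_def S'_def)
        with far x yV show ?thesis by (simp add: eq I_def L_def)
      qed
    qed
    have "card (far_triples V F P r) \<le> card ({e\<in>I. L e \<inter> S2 = {}} \<union> D')"
      using I(2) finD' by (intro card_mono cover) auto
    also have "\<dots> \<le> card {e\<in>I. L e \<inter> S2 = {}} + card D'" by (rule card_Un_le)
    finally have "real (card (far_triples V F P r)) \<le> card {e\<in>I. L e \<inter> S2 = {}} + 2 * real (card D)"
      using D' by linarith
    also have "real (card {e\<in>I. L e \<inter> S2 = {}}) \<le> r * n ^ 3"
    proof -
      have "(1 - r) ^ m2 * card I \<le> r * real (n ^ 3)"
        using m2 r \<open>card I \<le> n ^ 3\<close> by (intro mult_mono of_nat_mono) auto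
      with S2(3) show ?thesis by simp
    qed
    finally have "t * real (card (far_triples V F P r)) \<le> t * (r * n ^ 3 + 2 * real (card D))"
      using t(2) by (intro mult_left_mono) auto
    also have "\<dots> = \<epsilon> * n ^ 3 + 2 * (t * real (card D))"
      using t(2) by (simp add: r_def field_simps)
    also have "\<dots> \<le> \<epsilon> * n ^ 3 + 2 * (2 * n * (2 * \<epsilon> * (n * n) + card (unstable V F S S')))"
      using D by linarith
    \<comment> \<open>Triples missed by \<open>S2\<close> contribute \<open>\<epsilon>\<close>;
      \<open>V0\<close> and \<open>G\<close> contribute \<open>2 * \<epsilon>\<close> with total
      weight 4; unstable pairs enter with the same weight 4.\<close>
    also have "\<dots> = (9 * \<epsilon> * n\<^sup>2 + 4 * card (unstable V F S S')) * n"
      by (simp add: power2_eq_square power3_eq_cube algebra_simps)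
    finally show "\<exists>P S'. equipartition V P \<and> card P = t \<and> S \<subseteq> S' \<and> S' \<subseteq> V \<and> card S' \<le> m + m2 \<and>
        t * card (far_triples V F P (\<epsilon> / t))
          \<le> (9 * \<epsilon> * (card V)\<^sup>2 + 4 * card (unstable V F S S')) * card V"
      unfolding r_def n_def of_nat_mult using P(1,2) S' by (intro exI[of _ P] exI[of _ S']) simp
  qed
qed


section \<open>Iteration by a rank potential\<close>

text \<open>No rank rises when the sample grows, and each unstable pair loses at least 1.\<close>

lemma class_rank_sum_decrease:
  assumes "finite V" "links_bounded d V F" "S \<subseteq> S'"
  shows "(\<Sum>x\<in>V. \<Sum>y\<in>V. class_rank V F S' x y) + card (unstable V F S S')
    \<le> (\<Sum>x\<in>V. \<Sum>y\<in>V. class_rank V F S x y)"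
proof -
  let ?u = "\<lambda>x y. if class_rank V F S' x y \<noteq> class_rank V F S x y then 1 else (0::nat)"
  have "unstable V F S S' = Sigma V (\<lambda>x. {y\<in>V. class_rank V F S' x y \<noteq> class_rank V F S x y})"
    by (auto simp: unstable_def)
  then have "card (unstable V F S S') =
      (\<Sum>x\<in>V. card {y\<in>V. class_rank V F S' x y \<noteq> class_rank V F S x y})"
    using assms(1) by simp
  also have "\<dots> = (\<Sum>x\<in>V. \<Sum>y\<in>V. ?u x y)"
    by (simp only: card_eq_sum sum.inter_filter[OF assms(1)])
  finally have "(\<Sum>x\<in>V. \<Sum>y\<in>V. class_rank V F S' x y) + card (unstable V F S S')
      = (\<Sum>x\<in>V. \<Sum>y\<in>V. class_rank V F S' x y + ?u x y)"
    by (simp only: sum.distrib)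
  also have "\<dots> \<le> (\<Sum>x\<in>V. \<Sum>y\<in>V. class_rank V F S x y)"
  proof (intro sum_mono)
    fix x y assume "x \<in> V"
    from class_rank_antimono[OF assms(2) this assms(3), of y]
    show "class_rank V F S' x y + ?u x y \<le> class_rank V F S x y" by simp
  qed
  finally show ?thesis .
qed

text \<open>The induction variable \<open>j\<close> is the budget of the potential in units of
  \<open>\<epsilon> * (card V)\<^sup>2\<close>. A refinement that fails to give a good partition
  spends at least one unit, and with budget 0 the hypothesis is contradictory.\<close>

lemma few_far_triples_from_sample:
  fixes \<epsilon> :: real and j :: nat
  assumes "0 < \<epsilon>" "\<epsilon> < 1"
  shows "\<exists>T N. \<forall>V (F :: 'a set set) S. finite V \<longrightarrow> N \<le> card V \<longrightarrow> links_bounded d V F \<longrightarrow>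
    S \<subseteq> V \<longrightarrow> card S \<le> m \<longrightarrow>
    real (\<Sum>x\<in>V. \<Sum>y\<in>V. class_rank V F S x y) < j * (\<epsilon> * (card V)\<^sup>2) \<longrightarrow>
    (\<exists>P. equipartition V P \<and> t0 \<le> card P \<and> card P \<le> T \<and>
      card P * card (far_triples V F P (\<epsilon> / card P)) \<le> 13 * \<epsilon> * card V ^ 3)"
    (is "\<exists>T N. \<forall>V F S. ?claim j m T N V F S")
proof (induction j arbitrary: m)
  case (0 m)
  have "\<not> real (\<Sum>x\<in>V. \<Sum>y\<in>V. class_rank V F S x y) < real 0 * (\<epsilon> * (card V)\<^sup>2)"
    for V and F :: "'a set set" and S by (simp only: of_nat_0 mult_zero_left not_less of_nat_0_le_iff)
  then show ?case by blast
next
  case (Suc j m)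
  obtain t m' N where t: "t0 \<le> t" "0 < t"
    and step: "\<And>V (F :: 'a set set) S. finite V \<Longrightarrow> N \<le> card V \<Longrightarrow> links_bounded d V F \<Longrightarrow>
      S \<subseteq> V \<Longrightarrow> card S \<le> m \<Longrightarrow>
      \<exists>P S'. equipartition V P \<and> card P = t \<and> S \<subseteq> S' \<and> S' \<subseteq> V \<and> card S' \<le> m' \<and>
        t * card (far_triples V F P (\<epsilon> / t))
          \<le> (9 * \<epsilon> * (card V)\<^sup>2 + 4 * card (unstable V F S S')) * card V"
    by (rule refinement_step[OF assms]) (rule that)
  \<comment> \<open>The sample has grown, so the induction hypothesis is used with the new size
    bound \<open>m'\<close>, which depends only on \<open>m\<close> and the fixed
    parameters.\<close>
  from Suc[of m'] obtain T N' where IH: "\<forall>V F S. ?claim j m' T N' V F S" by blast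
  show ?case
  proof (rule exI[of _ "max t T"], rule exI[of _ "max N N'"], intro allI impI)
    fix V and F :: "'a set set" and S
    assume fin: "finite V" and N: "max N N' \<le> card V" and bd: "links_bounded d V F"
      and S: "S \<subseteq> V" "card S \<le> m"
      and rk: "real (\<Sum>x\<in>V. \<Sum>y\<in>V. class_rank V F S x y) < real (Suc j) * (\<epsilon> * (card V)\<^sup>2)"
    from step[OF fin _ bd S] N obtain P S' where P: "equipartition V P" "card P = t"
      "S \<subseteq> S'" "S' \<subseteq> V" "card S' \<le> m'"
      and far: "t * card (far_triples V F P (\<epsilon> / t))
          \<le> (9 * \<epsilon> * (card V)\<^sup>2 + 4 * card (unstable V F S S')) * card V" by auto
    show "\<exists>P. equipartition V P \<and> t0 \<le> card P \<and> card P \<le> max t T \<and>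
      card P * card (far_triples V F P (\<epsilon> / card P)) \<le> 13 * \<epsilon> * card V ^ 3"
    \<comment> \<open>Few unstable pairs turn the constants 9 and 4 into 13. Otherwise the potential
      falls by more than one unit and the recursion continues from \<open>S'\<close>.\<close>
    proof (cases "card (unstable V F S S') \<le> \<epsilon> * (card V)\<^sup>2")
      case True
      then have "(9 * \<epsilon> * (card V)\<^sup>2 + 4 * card (unstable V F S S')) * card V
          \<le> (9 * \<epsilon> * (card V)\<^sup>2 + 4 * (\<epsilon> * (card V)\<^sup>2)) * card V"
        by (intro mult_right_mono) auto
      also have "\<dots> = 13 * \<epsilon> * card V ^ 3"
        by (simp add: power2_eq_square power3_eq_cube algebra_simps)
      finally show ?thesis using far P t by (intro exI[of _ P]) simp
    next
      case False
      have "real (\<Sum>x\<in>V. \<Sum>y\<in>V. class_rank V F S' x y) + real (card (unstable V F S S'))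
          \<le> real (\<Sum>x\<in>V. \<Sum>y\<in>V. class_rank V F S x y)"
        unfolding of_nat_add[symmetric] of_nat_le_iff
        by (rule class_rank_sum_decrease[OF fin bd P(3)])
      with rk False have "real (\<Sum>x\<in>V. \<Sum>y\<in>V. class_rank V F S' x y) < j * (\<epsilon> * (card V)\<^sup>2)"
        by (simp only: of_nat_Suc distrib_right mult_1)
      moreover have "N' \<le> card V" using N by simp
      ultimately obtain P' where "equipartition V P'" "t0 \<le> card P'" "card P' \<le> T"
        "card P' * card (far_triples V F P' (\<epsilon> / card P')) \<le> 13 * \<epsilon> * card V ^ 3"
        using IH[rule_format, OF fin _ bd P(4,5)] by blast
      then show ?thesis by (intro exI[of _ P']) simp
    qed
  qed
qed

lemma few_far_triples:
  fixes \<epsilon> :: real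
  assumes "0 < \<epsilon>" "\<epsilon> < 1"
  obtains T N :: nat where
    "\<And>V (F :: 'a set set). finite V \<Longrightarrow> N \<le> card V \<Longrightarrow> links_bounded d V F \<Longrightarrow>
      \<exists>P. equipartition V P \<and> t0 \<le> card P \<and> card P \<le> T \<and>
        card P * card (far_triples V F P (\<epsilon> / card P)) \<le> 13 * \<epsilon> * card V ^ 3"
proof -
  \<comment> \<open>Every rank is at most \<open>d\<close>, so the empty sample starts below a
    budget of \<open>j > d / \<epsilon>\<close> units.\<close>
  define j where "j = nat \<lceil>d / \<epsilon>\<rceil> + 1"
  have "d / \<epsilon> < j" unfolding j_def by linarith
  then have j: "d < j * \<epsilon>" using assms(1) by (simp add: field_simps)
  from few_far_triples_from_sample[OF assms, of d 0 j t0] obtain T N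
    where TN: "\<forall>V (F :: 'a set set) S. finite V \<longrightarrow> N \<le> card V \<longrightarrow> links_bounded d V F \<longrightarrow>
    S \<subseteq> V \<longrightarrow> card S \<le> 0 \<longrightarrow>
    real (\<Sum>x\<in>V. \<Sum>y\<in>V. class_rank V F S x y) < j * (\<epsilon> * (card V)\<^sup>2) \<longrightarrow>
    (\<exists>P. equipartition V P \<and> t0 \<le> card P \<and> card P \<le> T \<and>
      card P * card (far_triples V F P (\<epsilon> / card P)) \<le> 13 * \<epsilon> * card V ^ 3)" by (elim exE)
  show ?thesis
  \<comment> \<open>At least one vertex is required to make the initial inequality strict.\<close>
  proof (rule that[where N = "max N 1" and T = T])
    fix V and F :: "'a set set"
    assume fin: "finite V" and N: "max N 1 \<le> card V" and bd: "links_bounded d V F"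
    then have V: "finite V" "N \<le> card V" "links_bounded d V F" and pos: "0 < card V" by auto
    have "(\<Sum>x\<in>V. \<Sum>y\<in>V. class_rank V F {} x y) \<le> (\<Sum>x\<in>V. \<Sum>y\<in>V. d)"
      using class_rank_le[OF V(3)] by (intro sum_mono)
    then have "(\<Sum>x\<in>V. \<Sum>y\<in>V. class_rank V F {} x y) \<le> d * (card V)\<^sup>2"
      by (simp add: power2_eq_square algebra_simps)
    then have "real (\<Sum>x\<in>V. \<Sum>y\<in>V. class_rank V F {} x y) \<le> real (d * (card V)\<^sup>2)"
      by (rule of_nat_mono)
    also have "\<dots> < (j * \<epsilon>) * (card V)\<^sup>2"
      unfolding of_nat_mult using j pos by (intro mult_strict_right_mono) auto
    finally have "real (\<Sum>x\<in>V. \<Sum>y\<in>V. class_rank V F {} x y) < j * (\<epsilon> * (card V)\<^sup>2)"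
      by (simp only: mult.assoc)
    with TN[rule_format, OF V, of "{}"]
    show "\<exists>P. equipartition V P \<and> t0 \<le> card P \<and> card P \<le> T \<and>
        card P * card (far_triples V F P (\<epsilon> / card P)) \<le> 13 * \<epsilon> * card V ^ 3" by simp
  qed
qed

section \<open>From homogeneous links to discrepancy\<close>

definition edge_ind :: "'a set set \<Rightarrow> 'a \<Rightarrow> 'a \<Rightarrow> 'a \<Rightarrow> real" where
  "edge_ind F x y z = of_bool ({x, y, z} \<in> F)"

lemma card_filter_of_bool:
  assumes "finite A"
  shows "real (card {x\<in>A. Q x}) = (\<Sum>x\<in>A. of_bool (Q x))"
  using assms by (simp add: Int_def of_bool_def sum.If_cases)

text \<open>An edge meets each of the three disjoint sets in one vertex, so it arises from exactly
  one triple.\<close>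

lemma card_edges_K3:
  assumes "finite X" "finite Y" "finite Z" "X \<inter> Y = {}" "Y \<inter> Z = {}" "X \<inter> Z = {}"
  shows "real (card (F \<inter> K3 X Y Z)) = (\<Sum>x\<in>X. \<Sum>y\<in>Y. \<Sum>z\<in>Z. edge_ind F x y z)"
proof -
  let ?E = "{e \<in> X \<times> Y \<times> Z. case e of (x, y, z) \<Rightarrow> {x, y, z} \<in> F}"
  let ?s = "\<lambda>(x, y, z). {x, y, z}"
  have inj: "inj_on ?s ?E"
  proof (rule inj_onI)
    fix e e' assume e: "e \<in> ?E" "e' \<in> ?E" and "?s e = ?s e'"
    obtain x y z x' y' z' where xyz: "e = (x, y, z)" "e' = (x', y', z')" by (cases e, cases e')
    with e have mem: "x \<in> X" "y \<in> Y" "z \<in> Z" "x' \<in> X" "y' \<in> Y" "z' \<in> Z" by auto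
    have eq: "{x, y, z} = {x', y', z'}" using \<open>?s e = ?s e'\<close> unfolding xyz by (simp only: case_prod_conv)
    have "x = x'"
    proof -
      have "{x, y, z} \<inter> X = {x}" "{x', y', z'} \<inter> X = {x'}" using mem assms(4-6) by blast+
      with eq show ?thesis by (metis singleton_inject)
    qed
    moreover have "y = y'"
    proof -
      have "{x, y, z} \<inter> Y = {y}" "{x', y', z'} \<inter> Y = {y'}" using mem assms(4-6) by blast+
      with eq show ?thesis by (metis singleton_inject)
    qed
    moreover have "z = z'"
    proof -
      have "{x, y, z} \<inter> Z = {z}" "{x', y', z'} \<inter> Z = {z'}" using mem assms(4-6) by blast+
      with eq show ?thesis by (metis singleton_inject)
    qed
    ultimately show "e = e'" unfolding xyz by simp
  qed
  have img: "?s ` ?E = F \<inter> K3 X Y Z"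
  proof (intro equalityI subsetI)
    fix e assume "e \<in> ?s ` ?E"
    then obtain x y z where "x \<in> X" "y \<in> Y" "z \<in> Z" "{x, y, z} \<in> F" "e = {x, y, z}" by auto
    moreover from this assms(4-6) have "x \<noteq> y" "y \<noteq> z" "x \<noteq> z" by auto
    ultimately show "e \<in> F \<inter> K3 X Y Z" unfolding K3_def by blast
  next
    fix e assume "e \<in> F \<inter> K3 X Y Z"
    then obtain x y z where "x \<in> X" "y \<in> Y" "z \<in> Z" "{x, y, z} \<in> F" "e = {x, y, z}"
      unfolding K3_def by blast
    then show "e \<in> ?s ` ?E" by (intro image_eqI[of _ _ "(x, y, z)"]) auto
  qed
  have "card (F \<inter> K3 X Y Z) = card ?E" unfolding img[symmetric] by (rule card_image[OF inj])
  then have "real (card (F \<inter> K3 X Y Z)) = card ?E" by (rule arg_cong)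
  also have "real (card ?E) = (\<Sum>e\<in>X \<times> Y \<times> Z. of_bool (case e of (x, y, z) \<Rightarrow> {x, y, z} \<in> F))"
    by (rule card_filter_of_bool) (use assms in auto)
  also have "\<dots> = (\<Sum>x\<in>X. \<Sum>y\<in>Y. \<Sum>z\<in>Z. edge_ind F x y z)"
    by (simp add: sum.cartesian_product edge_ind_def case_prod_unfold)
  finally show ?thesis .
qed

definition far_in :: "'a set \<Rightarrow> 'a set set \<Rightarrow> real \<Rightarrow> 'a set \<Rightarrow> 'a set \<Rightarrow> ('a \<times> 'a \<times> 'a) set" where
  "far_in V F r A B =
     {(a, b, b') \<in> A \<times> B \<times> B. r * card V \<le> card (link_diff V F a b b')}"

text \<open>A pair that is not far differs on fewer than
  \<open>r * card V \<le> \<delta> * card C\<close> vertices of \<open>C\<close>; a far pair costs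
  at most \<open>card C\<close>, and there are few. The order of summation fits the exchange of one
  coordinate at a time.\<close>

lemma link_variation_le:
  fixes \<delta> r :: real
  assumes "finite V" "A \<subseteq> V" "B \<subseteq> V" "C \<subseteq> V" and \<delta>: "0 \<le> \<delta>" and r: "r * card V \<le> \<delta> * card C"
    and far: "card (far_in V F r A B) \<le> \<delta> * card A * (card B)\<^sup>2"
  shows "(\<Sum>b\<in>B. \<Sum>a\<in>A. \<Sum>c\<in>C. \<Sum>b'\<in>B. \<bar>edge_ind F a b c - edge_ind F a b' c\<bar>)
    \<le> 2 * \<delta> * card A * (card B)\<^sup>2 * card C"
proof -
  let ?far = "\<lambda>a b b'. r * card V \<le> card (link_diff V F a b b')"
  have fin: "finite A" "finite B" "finite C" using assms finite_subset by blast+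
  have inner: "(\<Sum>c\<in>C. \<bar>edge_ind F a b c - edge_ind F a b' c\<bar>)
      \<le> \<delta> * card C + card C * of_bool (?far a b b')" for a b b'
  proof -
    have "(\<Sum>c\<in>C. \<bar>edge_ind F a b c - edge_ind F a b' c\<bar>)
        = (\<Sum>c\<in>C. of_bool (({a, b, c} \<in> F) \<noteq> ({a, b', c} \<in> F)))"
      by (intro sum.cong) (auto simp: edge_ind_def)
    also have "\<dots> = card {c\<in>C. ({a, b, c} \<in> F) \<noteq> ({a, b', c} \<in> F)}"
      by (rule card_filter_of_bool[OF fin(3), symmetric])
    finally have eq: "(\<Sum>c\<in>C. \<bar>edge_ind F a b c - edge_ind F a b' c\<bar>)
        = card {c\<in>C. ({a, b, c} \<in> F) \<noteq> ({a, b', c} \<in> F)}" .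
    have 1: "card {c\<in>C. ({a, b, c} \<in> F) \<noteq> ({a, b', c} \<in> F)} \<le> card C"
      using fin(3) by (intro card_mono) auto
    have 2: "card {c\<in>C. ({a, b, c} \<in> F) \<noteq> ({a, b', c} \<in> F)} \<le> card (link_diff V F a b b')"
      unfolding link_diff_def using assms(1,4) by (intro card_mono) auto
    have "0 \<le> \<delta> * card C" using \<delta> by simp
    with eq 1 2 r show ?thesis by (cases "?far a b b'") auto
  qed
  define S :: real where "S = (\<Sum>b\<in>B. \<Sum>a\<in>A. \<Sum>b'\<in>B. of_bool (?far a b b'))"
  have "S = (\<Sum>a\<in>A. \<Sum>b\<in>B. \<Sum>b'\<in>B. (of_bool (?far a b b') :: real))"
    unfolding S_def by (rule sum.swap)
  also have "\<dots> = (\<Sum>e\<in>A \<times> B \<times> B. of_bool (case e of (a, b, b') \<Rightarrow> ?far a b b'))"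
    by (simp add: sum.cartesian_product case_prod_unfold)
  also have "\<dots> = card {e \<in> A \<times> B \<times> B. case e of (a, b, b') \<Rightarrow> ?far a b b'}"
    by (rule card_filter_of_bool[symmetric]) (use fin in auto)
  also have "{e \<in> A \<times> B \<times> B. case e of (a, b, b') \<Rightarrow> ?far a b b'} = far_in V F r A B"
    by (auto simp: far_in_def)
  finally have count: "S \<le> \<delta> * card A * (card B)\<^sup>2"
    using far by simp
  have "(\<Sum>b\<in>B. \<Sum>a\<in>A. \<Sum>c\<in>C. \<Sum>b'\<in>B. \<bar>edge_ind F a b c - edge_ind F a b' c\<bar>)
      = (\<Sum>b\<in>B. \<Sum>a\<in>A. \<Sum>b'\<in>B. \<Sum>c\<in>C. \<bar>edge_ind F a b c - edge_ind F a b' c\<bar>)"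
    by (intro sum.cong refl sum.swap)
  also have "\<dots> \<le> (\<Sum>b\<in>B. \<Sum>a\<in>A. \<Sum>b'\<in>B. \<delta> * card C + card C * of_bool (?far a b b'))"
    by (intro sum_mono inner)
  also have "\<dots> = \<delta> * card A * (card B)\<^sup>2 * card C
      + card C * S"
    by (simp add: S_def sum.distrib sum_distrib_left power2_eq_square)
  also have "\<dots> \<le> \<delta> * card A * (card B)\<^sup>2 * card C + card C * (\<delta> * card A * (card B)\<^sup>2)"
    using count by (intro add_left_mono mult_left_mono) auto
  also have "\<dots> = 2 * \<delta> * card A * (card B)\<^sup>2 * card C" by simp
  finally show ?thesis .
qed


text \<open>Moving one coordinate at a time from \<open>(a, b, c)\<close> to
  \<open>(a', b', c')\<close> shows that the edge indicator is close in the L1 sense to its average.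
  This bounds the deviation on all subsets simultaneously. Each of the three moves uses one
  hypothesis on far pairs.\<close>

lemma vdisc3_of_links:
  fixes \<delta> r :: real
  assumes "finite V" and sub: "X \<subseteq> V" "Y \<subseteq> V" "Z \<subseteq> V"
    and disj: "X \<inter> Y = {}" "Y \<inter> Z = {}" "X \<inter> Z = {}"
    and ne: "X \<noteq> {}" "Y \<noteq> {}" "Z \<noteq> {}" and \<delta>: "0 \<le> \<delta>"
    and r: "r * card V \<le> \<delta> * card X" "r * card V \<le> \<delta> * card Y" "r * card V \<le> \<delta> * card Z"
    and far: "card (far_in V F r Y X) \<le> \<delta> * card Y * (card X)\<^sup>2"
      "card (far_in V F r Z Y) \<le> \<delta> * card Z * (card Y)\<^sup>2"
      "card (far_in V F r X Z) \<le> \<delta> * card X * (card Z)\<^sup>2"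
  shows "vdisc3 (6 * \<delta>) X Y Z (F \<inter> K3 X Y Z)"
proof -
  have fin: "finite X" "finite Y" "finite Z" using assms(1) sub finite_subset by blast+
  let ?f = "edge_ind F"
  define x y z where "x = real (card X)" and "y = real (card Y)" and "z = real (card Z)"
  have pos: "0 < x" "0 < y" "0 < z"
    using fin ne by (auto simp: x_def y_def z_def card_gt_0_iff)
  define N where "N = x * y * z"
  have N: "0 < N" using pos by (simp add: N_def)
  have S1: "(\<Sum>a\<in>X. \<Sum>b\<in>Y. \<Sum>c\<in>Z. \<Sum>a'\<in>X. \<bar>?f a b c - ?f a' b c\<bar>) \<le> 2 * \<delta> * y * x\<^sup>2 * z"
    using link_variation_le[OF assms(1) sub(2,1,3) \<delta> r(3) far(1)]
    by (simp add: x_def y_def z_def edge_ind_def insert_commute)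
  have S2: "(\<Sum>b\<in>Y. \<Sum>c\<in>Z. \<Sum>a'\<in>X. \<Sum>b'\<in>Y. \<bar>?f a' b c - ?f a' b' c\<bar>) \<le> 2 * \<delta> * z * y\<^sup>2 * x"
    using link_variation_le[OF assms(1) sub(3,2,1) \<delta> r(1) far(2)]
    by (simp add: x_def y_def z_def edge_ind_def insert_commute)
  have S3: "(\<Sum>c\<in>Z. \<Sum>a'\<in>X. \<Sum>b'\<in>Y. \<Sum>c'\<in>Z. \<bar>?f a' b' c - ?f a' b' c'\<bar>) \<le> 2 * \<delta> * x * z\<^sup>2 * y"
    using link_variation_le[OF assms(1) sub(1,3,2) \<delta> r(2) far(3)]
    by (simp add: x_def y_def z_def edge_ind_def insert_commute)
  define A where "A a b c = (\<Sum>a'\<in>X. \<Sum>b'\<in>Y. \<Sum>c'\<in>Z. \<bar>?f a b c - ?f a' b' c'\<bar>)" for a b c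
  have A0: "0 \<le> A a b c" for a b c unfolding A_def by (intro sum_nonneg) simp
  have "(\<Sum>a\<in>X. \<Sum>b\<in>Y. \<Sum>c\<in>Z. A a b c) \<le>
      (\<Sum>a\<in>X. \<Sum>b\<in>Y. \<Sum>c\<in>Z. \<Sum>a'\<in>X. \<Sum>b'\<in>Y. \<Sum>c'\<in>Z.
        \<bar>?f a b c - ?f a' b c\<bar> + (\<bar>?f a' b c - ?f a' b' c\<bar> + \<bar>?f a' b' c - ?f a' b' c'\<bar>))"
    unfolding A_def by (intro sum_mono) linarith
  \<comment> \<open>Each of the three differences is independent of two of the six summation
    variables, which gives the products in front.\<close>
  also have "\<dots> = y * z * (\<Sum>a\<in>X. \<Sum>b\<in>Y. \<Sum>c\<in>Z. \<Sum>a'\<in>X. \<bar>?f a b c - ?f a' b c\<bar>)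
      + (x * z * (\<Sum>b\<in>Y. \<Sum>c\<in>Z. \<Sum>a'\<in>X. \<Sum>b'\<in>Y. \<bar>?f a' b c - ?f a' b' c\<bar>)
      + x * y * (\<Sum>c\<in>Z. \<Sum>a'\<in>X. \<Sum>b'\<in>Y. \<Sum>c'\<in>Z. \<bar>?f a' b' c - ?f a' b' c'\<bar>))"
    by (simp add: sum.distrib x_def y_def z_def mult.assoc flip: sum_distrib_left)
      (simp add: distrib_left)
  also have "\<dots> \<le> y * z * (2 * \<delta> * y * x\<^sup>2 * z) + (x * z * (2 * \<delta> * z * y\<^sup>2 * x)
      + x * y * (2 * \<delta> * x * z\<^sup>2 * y))"
    using pos S1 S2 S3 by (intro add_mono mult_left_mono) auto
  also have "\<dots> = 6 * \<delta> * N * N" by (simp add: N_def power2_eq_square)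
  finally have total: "(\<Sum>a\<in>X. \<Sum>b\<in>Y. \<Sum>c\<in>Z. A a b c) \<le> 6 * \<delta> * N * N" .
  define D where "D = (\<Sum>a\<in>X. \<Sum>b\<in>Y. \<Sum>c\<in>Z. ?f a b c)"
  have point: "\<bar>N * ?f a b c - D\<bar> \<le> A a b c" for a b c
  proof -
    have "N * ?f a b c - D = (\<Sum>a'\<in>X. \<Sum>b'\<in>Y. \<Sum>c'\<in>Z. ?f a b c - ?f a' b' c')"
      by (simp add: D_def N_def sum_subtractf x_def y_def z_def)
    then show ?thesis unfolding A_def by (auto intro!: order_trans[OF sum_abs] sum_mono)
  qed
  have dev: "\<bar>real (card (F \<inter> K3 X Y Z \<inter> K3 U V' W)) - D / N * card U * card V' * card W\<bar>
      \<le> 6 * \<delta> * card X * card Y * card Z"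
    if UVW: "U \<subseteq> X" "V' \<subseteq> Y" "W \<subseteq> Z" for U V' W
  proof -
    have "F \<inter> K3 X Y Z \<inter> K3 U V' W = F \<inter> K3 U V' W"
      using UVW unfolding K3_def by blast
    moreover have "real (card (F \<inter> K3 U V' W)) = (\<Sum>a\<in>U. \<Sum>b\<in>V'. \<Sum>c\<in>W. ?f a b c)"
      by (rule card_edges_K3) (use UVW fin disj finite_subset in blast)+
    ultimately have "N * (card (F \<inter> K3 X Y Z \<inter> K3 U V' W) - D / N * card U * card V' * card W)
        = (\<Sum>a\<in>U. \<Sum>b\<in>V'. \<Sum>c\<in>W. N * ?f a b c - D)"
      using N by (simp add: sum_subtractf right_diff_distrib flip: sum_distrib_left)
    then have "\<bar>N * (card (F \<inter> K3 X Y Z \<inter> K3 U V' W) - D / N * card U * card V' * card W)\<bar>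
        \<le> (\<Sum>a\<in>U. \<Sum>b\<in>V'. \<Sum>c\<in>W. A a b c)"
      using point by (auto intro!: order_trans[OF sum_abs] sum_mono)
    \<comment> \<open>Because \<open>A\<close> is nonnegative, the subsets may now be enlarged to
      the full parts, one at a time.\<close>
    also have "\<dots> \<le> (\<Sum>a\<in>U. \<Sum>b\<in>V'. \<Sum>c\<in>Z. A a b c)"
      using UVW fin A0 by (intro sum_mono sum_mono2) auto
    also have "\<dots> \<le> (\<Sum>a\<in>U. \<Sum>b\<in>Y. \<Sum>c\<in>Z. A a b c)"
      using UVW fin A0 by (intro sum_mono sum_mono2 sum_nonneg) auto
    also have "\<dots> \<le> (\<Sum>a\<in>X. \<Sum>b\<in>Y. \<Sum>c\<in>Z. A a b c)"
      using UVW fin A0 by (intro sum_mono2 sum_nonneg) auto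
    also note total
    finally have "N * \<bar>card (F \<inter> K3 X Y Z \<inter> K3 U V' W) - D / N * card U * card V' * card W\<bar>
        \<le> N * (6 * \<delta> * N)"
      using N by (simp add: abs_mult mult.commute mult.left_commute)
    then have "\<bar>card (F \<inter> K3 X Y Z \<inter> K3 U V' W) - D / N * card U * card V' * card W\<bar>
        \<le> 6 * \<delta> * N"
      using N by (rule mult_left_le_imp_le)
    then show ?thesis by (simp add: N_def x_def y_def z_def mult.assoc)
  qed
  have "real (card (F \<inter> K3 X Y Z)) = D"
    unfolding D_def by (rule card_edges_K3[OF fin disj])
  then have "real (card (F \<inter> K3 X Y Z)) = D / N * card X * card Y * card Z"
    using pos by (simp add: N_def x_def y_def z_def)
  with dev fin disj show ?thesis
    unfolding vdisc3_def tripartite_def by (intro conjI exI[of _ "D / N"]) auto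
qed

text \<open>Changing the edges costs at most \<open>\<kappa>\<close> in the count on subsets and at
  most \<open>\<kappa>\<close> in the density, hence \<open>2 * \<kappa>\<close>.\<close>

lemma vdisc3_perturb:
  fixes \<eta> \<kappa> :: real
  assumes disc: "vdisc3 \<eta> X Y Z (F' \<inter> K3 X Y Z)" and "finite F" "finite F'"
    and ne: "X \<noteq> {}" "Y \<noteq> {}" "Z \<noteq> {}"
    and close: "card (sym_diff F F') \<le> \<kappa> * (card X * card Y * card Z)"
    and "\<eta> + 2 * \<kappa> \<le> \<epsilon>"
  shows "vdisc3 \<epsilon> X Y Z (F \<inter> K3 X Y Z)"
proof -
  have tri: "tripartite X Y Z (F' \<inter> K3 X Y Z)" using disc by (simp add: vdisc3_def)
  then have fin: "finite X" "finite Y" "finite Z" by (auto simp: tripartite_def)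
  define N where "N = real (card X * card Y * card Z)"
  have N: "0 < N" using fin ne by (simp add: N_def card_gt_0_iff)
  from disc obtain d :: real where d: "real (card (F' \<inter> K3 X Y Z)) = d * card X * card Y * card Z"
    and dev0: "\<forall>U\<subseteq>X. \<forall>V\<subseteq>Y. \<forall>W\<subseteq>Z.
       \<bar>real (card (F' \<inter> K3 X Y Z \<inter> K3 U V W)) - d * card U * card V * card W\<bar>
         \<le> \<eta> * card X * card Y * card Z"
    unfolding vdisc3_def by (elim conjE exE)
  have dev: "\<bar>real (card (F' \<inter> K3 X Y Z \<inter> K3 U V W)) - d * card U * card V * card W\<bar>
      \<le> \<eta> * card X * card Y * card Z" if "U \<subseteq> X" "V \<subseteq> Y" "W \<subseteq> Z" for U V W
    using dev0 that by simp
  have near: "\<bar>real (card (F \<inter> S)) - real (card (F' \<inter> S))\<bar> \<le> \<kappa> * N" for S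
  proof -
    have "card (F \<inter> S) \<le> card (F' \<inter> S) + card (sym_diff F F')"
      "card (F' \<inter> S) \<le> card (F \<inter> S) + card (sym_diff F F')"
      using assms(2,3) by (intro order_trans[OF card_mono card_Un_le]; auto)+
    with close show ?thesis by (simp add: N_def)
  qed
  define e where "e = real (card (F \<inter> K3 X Y Z)) / N"
  have "\<bar>(e - d) * N\<bar> \<le> \<kappa> * N"
    using near[of "K3 X Y Z"] N d by (simp add: e_def N_def left_diff_distrib mult.assoc)
  then have ed: "\<bar>e - d\<bar> \<le> \<kappa>" using N by (simp add: abs_mult)
  have "\<bar>real (card (F \<inter> K3 X Y Z \<inter> K3 U V W)) - e * card U * card V * card W\<bar>
      \<le> \<epsilon> * card X * card Y * card Z" if "U \<subseteq> X" "V \<subseteq> Y" "W \<subseteq> Z" for U V W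
  proof -
    have "card U * card V * card W \<le> card X * card Y * card Z"
      using that fin by (intro mult_le_mono card_mono)
    then have uvw: "real (card U * card V * card W) \<le> N"
      unfolding N_def by (rule of_nat_mono)
    have "\<bar>(e - d) * real (card U * card V * card W)\<bar> \<le> \<kappa> * N"
      unfolding abs_mult using ed uvw by (intro mult_mono) auto
    moreover have "(e - d) * real (card U * card V * card W)
        = e * card U * card V * card W - d * card U * card V * card W"
      by (simp add: left_diff_distrib mult.assoc)
    moreover have "\<bar>real (card (F' \<inter> K3 X Y Z \<inter> K3 U V W)) - d * card U * card V * card W\<bar>
        \<le> \<eta> * N"
      using dev[OF that] by (simp add: N_def mult.assoc)
    moreover note near[of "K3 X Y Z \<inter> K3 U V W"]
    ultimately have "\<bar>real (card (F \<inter> K3 X Y Z \<inter> K3 U V W)) - e * card U * card V * card W\<bar>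
        \<le> \<eta> * N + \<kappa> * N + \<kappa> * N"
      unfolding Int_assoc by linarith
    also have "\<dots> = (\<eta> + 2 * \<kappa>) * N" by (simp add: algebra_simps)
    also have "\<dots> \<le> \<epsilon> * N" using assms(8) N by (intro mult_right_mono) auto
    finally show ?thesis by (simp add: N_def mult.assoc)
  qed
  moreover have "e * N = real (card (F \<inter> K3 X Y Z))" using N by (simp add: e_def)
  then have "real (card (F \<inter> K3 X Y Z)) = e * card X * card Y * card Z"
    by (simp add: N_def mult.assoc)
  ultimately show ?thesis
    using tri unfolding vdisc3_def tripartite_def by (intro conjI exI[of _ e]) auto
qed

section \<open>Counting bad pairs and choosing the constants\<close>

definition bad_pairs :: "'a set \<Rightarrow> 'a set set \<Rightarrow> 'a set set \<Rightarrow> real \<Rightarrow> real \<Rightarrow> ('a set \<times> 'a set) set" where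
  "bad_pairs V F P r \<delta> = {(A, B) \<in> P \<times> P. \<delta> * card A * (card B)\<^sup>2 < card (far_in V F r A B)}"

text \<open>The far triples of different pairs of parts are disjoint. Each bad pair contributes at
  least \<open>\<delta> * (n / (2 * t)) ^ 3\<close> of the at most
  \<open>\<epsilon> * n ^ 3 / t\<close> far triples, where \<open>n = card V\<close> and
  \<open>t = card P\<close>.\<close>

lemma card_bad_pairs_le:
  fixes \<delta> \<epsilon> :: real
  assumes fin: "finite V" and eq: "equipartition V P" and big: "0 < card P" "2 * card P \<le> card V"
    and \<delta>: "0 < \<delta>" and "0 \<le> \<epsilon>"
    and far: "card P * card (far_triples V F P r) \<le> \<epsilon> * card V ^ 3"
  shows "card (bad_pairs V F P r \<delta>) * \<delta> \<le> 8 * \<epsilon> * (card P)\<^sup>2"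
proof -
  have part: "partition_on V P" using eq by (simp add: equipartition_def)
  have finP: "finite P" using finite_elements[OF fin part] .
  define n t where "n = real (card V)" and "t = real (card P)"
  have pos: "0 < n" "0 < t" using big by (auto simp: n_def t_def)
  let ?B = "bad_pairs V F P r \<delta>"
  have B: "?B \<subseteq> P \<times> P" by (auto simp: bad_pairs_def)
  then have finB: "finite ?B" using finP by (simp add: finite_subset)
  have sub: "A \<subseteq> V" if "A \<in> P" for A using partition_onD1[OF part] that by auto
  have disj: "A \<inter> B = {}" if "A \<in> P" "B \<in> P" "A \<noteq> B" for A B
    using pairwiseD[OF partition_onD2[OF part] that] by (simp add: disjnt_def)
  have fin_far: "finite (far_triples V F P r)"
  proof (rule finite_subset[of _ "V \<times> V \<times> V"])
    show "far_triples V F P r \<subseteq> V \<times> V \<times> V" using sub by (auto simp: far_triples_def)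
  qed (use fin in simp)
  have fin_in: "finite (far_in V F r A B)" if "(A, B) \<in> ?B" for A B
  proof (rule finite_subset[of _ "A \<times> B \<times> B"])
    show "far_in V F r A B \<subseteq> A \<times> B \<times> B" by (auto simp: far_in_def)
    show "finite (A \<times> B \<times> B)"
      using that sub[of A] sub[of B] fin by (auto simp: bad_pairs_def intro: finite_subset)
  qed
  have lower: "\<delta> * n ^ 3 / (8 * t ^ 3) \<le> card (far_in V F r (fst e) (snd e))" if e: "e \<in> ?B" for e
  proof -
    obtain A B where AB: "e = (A, B)" "A \<in> P" "B \<in> P" "\<delta> * card A * (card B)\<^sup>2 < card (far_in V F r A B)"
      using e by (auto simp: bad_pairs_def)
    have "n / (2 * t) \<le> card A" "n / (2 * t) \<le> card B"
      using equipartition_card_bounds(1)[OF eq fin _ big(2)] AB(2,3) pos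
      by (auto simp: n_def t_def field_simps)
    then have "\<delta> * (n / (2 * t)) * (n / (2 * t))\<^sup>2 \<le> \<delta> * card A * (card B)\<^sup>2"
      using \<delta> pos by (intro mult_mono power_mono) auto
    with AB show ?thesis by (simp add: power2_eq_square power3_eq_cube)
  qed
  have "card ?B * (\<delta> * n ^ 3 / (8 * t ^ 3)) = (\<Sum>e\<in>?B. \<delta> * n ^ 3 / (8 * t ^ 3))" by simp
  also have "\<dots> \<le> (\<Sum>e\<in>?B. real (card (far_in V F r (fst e) (snd e))))"
    by (intro sum_mono lower)
  also have "\<dots> = real (card (\<Union>e\<in>?B. far_in V F r (fst e) (snd e)))"
  proof -
    have "far_in V F r (fst e) (snd e) \<inter> far_in V F r (fst e') (snd e') = {}"
      if "e \<in> ?B" "e' \<in> ?B" "e \<noteq> e'" for e e'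
    proof -
      have "fst e \<noteq> fst e' \<or> snd e \<noteq> snd e'" using that(3) by (simp add: prod_eq_iff)
      then have "fst e \<inter> fst e' = {} \<or> snd e \<inter> snd e' = {}"
        using disj B that(1,2) by (metis SigmaE fst_conv snd_conv subsetD)
      then show ?thesis by (auto simp: far_in_def)
    qed
    then show ?thesis using finB fin_in by (subst card_UN_disjoint) auto
  qed
  also have "\<dots> \<le> card (far_triples V F P r)"
  proof (intro of_nat_mono card_mono fin_far UN_least)
    fix e assume "e \<in> ?B"
    then have "fst e \<in> P" "snd e \<in> P" by (auto simp: bad_pairs_def)
    with sub[of "fst e"] show "far_in V F r (fst e) (snd e) \<subseteq> far_triples V F P r"
      by (auto simp: far_in_def far_triples_def)
  qed
  also have "\<dots> \<le> \<epsilon> * n ^ 3 / t" using far pos by (simp add: n_def t_def field_simps)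
  finally have "card ?B * \<delta> * n ^ 3 / (8 * t ^ 3) \<le> \<epsilon> * n ^ 3 / t" by simp
  then have "card ?B * \<delta> \<le> 8 * \<epsilon> * t\<^sup>2"
    using pos by (simp add: field_simps power2_eq_square power3_eq_cube)
  then show ?thesis by (simp add: t_def)
qed

theorem proposition2p45:
  fixes \<H> :: "('a set \<times> 'a set set) set"
  assumes "hereditary_property \<H>"
    and "\<exists>\<H>'. hereditary_property \<H>' \<and> slicewise_stable \<H>' \<and> close_to \<H> \<H>'"
  shows "binary_vdisc3_error \<H>"
  unfolding binary_vdisc3_error_def
proof (intro allI impI, elim conjE)
  fix \<epsilon> :: real and t0 :: nat
  assume \<epsilon>: "0 < \<epsilon>" and t0: "1 \<le> t0"
  from assms(2) obtain \<H>' where her: "hereditary_property \<H>'" and stab: "slicewise_stable \<H>'"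
    and close: "close_to \<H> \<H>'" by blast
  from stab obtain k where k: "\<And>V F. (V, F) \<in> \<H>' \<Longrightarrow> slicewise_k_stable k V F"
    by (auto simp: slicewise_stable_def)
  have graph: "three_graph V F" if "(V, F) \<in> \<H> \<or> (V, F) \<in> \<H>'" for V F
    using assms(1) her that by (auto simp: hereditary_property_def)
  obtain d where d: "\<And>V (F :: 'a set set) x. slicewise_k_stable k V F \<Longrightarrow> x \<in> V \<Longrightarrow>
      \<not> full_tree (\<lambda>y z. {x, y, z} \<in> F) V d V"
    by (rule slicewise_k_stable_tree_bound) (rule that)
  define e where "e = min \<epsilon> 1"
  \<comment> \<open>Half of the error, \<open>6 * \<delta> = e / 2\<close>, goes to the discrepancy
    for \<open>F'\<close>; the other half is twice the perturbation \<open>e / 4\<close>.\<close>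
  define \<delta> where "\<delta> = e / 12"
  \<comment> \<open>Here \<open>104 = 8 * 13\<close> combines the constants of the two counting
    lemmas, so that at most \<open>e * t\<^sup>2\<close> pairs are bad.\<close>
  define \<theta> where "\<theta> = e * \<delta> / 104"
  have e: "0 < e" "e \<le> 1" "e \<le> \<epsilon>" using \<epsilon> by (auto simp: e_def)
  have \<delta>: "0 < \<delta>" "\<delta> < 1" using e by (auto simp: \<delta>_def)
  have "e * \<delta> \<le> 1 * \<delta>" using e \<delta> by (intro mult_right_mono) auto
  moreover have "0 < e * \<delta>" using e \<delta> by simp
  ultimately have \<theta>: "0 < \<theta>" "\<theta> < 1" "2 * \<theta> \<le> \<delta>"
    using \<delta> unfolding \<theta>_def by linarith+
  obtain T N where TN: "\<And>V (F :: 'a set set). finite V \<Longrightarrow> N \<le> card V \<Longrightarrow> links_bounded d V F \<Longrightarrow>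
      \<exists>P. equipartition V P \<and> t0 \<le> card P \<and> card P \<le> T \<and>
        card P * card (far_triples V F P (\<theta> / card P)) \<le> 13 * \<theta> * card V ^ 3"
    by (rule few_far_triples[OF \<theta>(1,2), of d t0]) (rule that)
  define w where "w = real T + 1"
  \<comment> \<open>Chosen after \<open>T\<close>: parts have at least \<open>n / (2 * w)\<close>
    vertices, so \<open>\<alpha> * n ^ 3\<close> edits are at most a fraction \<open>e / 4\<close>
    of the triples across any three parts.\<close>
  define \<alpha> where "\<alpha> = e / 4 / (8 * w ^ 3)"
  have w: "0 < w" by (simp add: w_def)
  have \<alpha>: "0 < \<alpha>" using e w by (simp add: \<alpha>_def)
  with close obtain N1 where N1: "\<And>V F. (V, F) \<in> \<H> \<Longrightarrow> N1 \<le> card V \<Longrightarrow>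
      \<exists>F'. (V, F') \<in> \<H>' \<and> delta_close \<alpha> V F F'"
    unfolding close_to_def by fast
  show "\<exists>T N :: nat. \<forall>(V, F) \<in> \<H>. card V \<ge> N \<longrightarrow>
           (\<exists>P \<Sigma>. equipartition V P \<and> t0 \<le> card P \<and> card P \<le> T \<and>
              \<Sigma> \<subseteq> [P]\<^bsup>2\<^esup> \<and> real (card \<Sigma>) \<le> \<epsilon> * real (card P) ^ 2 \<and>
              (\<forall>X \<in> P. \<forall>Y \<in> P. \<forall>Z \<in> P.
                 X \<noteq> Y \<and> Y \<noteq> Z \<and> X \<noteq> Z \<and> {X, Y} \<notin> \<Sigma> \<and> {Y, Z} \<notin> \<Sigma> \<and> {X, Z} \<notin> \<Sigma> \<longrightarrow>
                 vdisc3 \<epsilon> X Y Z (F \<inter> K3 X Y Z)))"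
  proof (rule exI[of _ T], rule exI[of _ "max (max N N1) (2 * T)"], clarify)
    fix V F assume VF: "(V, F) \<in> \<H>" and big: "max (max N N1) (2 * T) \<le> card V"
    obtain F' where F': "(V, F') \<in> \<H>'" and near: "delta_close \<alpha> V F F'"
      using N1[OF VF] big by auto
    have fin: "finite V" and FV: "F \<subseteq> [V]\<^bsup>3\<^esup>" "F' \<subseteq> [V]\<^bsup>3\<^esup>"
      using graph VF F' by (auto simp: three_graph_def)
    then have finF: "finite F" "finite F'"
      using finite_imp_finite_nsets[OF fin] by (auto intro: finite_subset)
    \<comment> \<open>Stability is available for the approximating \<open>F'\<close> only; the
      partition is built from it and used for \<open>F\<close>.\<close>
    have bd: "links_bounded d V F'" using d[OF k[OF F']] by (simp add: links_bounded_def)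
    obtain P where P: "equipartition V P" "t0 \<le> card P" "card P \<le> T"
      "card P * card (far_triples V F' P (\<theta> / card P)) \<le> 13 * \<theta> * card V ^ 3"
      using TN[OF fin _ bd] big by auto
    have part: "partition_on V P" using P(1) by (simp add: equipartition_def)
    define t n where "t = real (card P)" and "n = real (card V)"
    define r where "r = \<theta> / t"
    have size: "0 < card P" "2 * card P \<le> card V" using P(2,3) t0 big by auto
    have pos: "0 < t" "0 < n" using size by (auto simp: t_def n_def)
    let ?B = "bad_pairs V F' P r \<delta>"
    have "card ?B * \<delta> \<le> 8 * (13 * \<theta>) * (card P)\<^sup>2"
      using P(4) \<theta>(1) \<delta>(1) by (intro card_bad_pairs_le[OF fin P(1) size]) (auto simp: r_def t_def)
    also have "\<dots> = (e * t\<^sup>2) * \<delta>" by (simp add: \<theta>_def t_def)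
    finally have "card ?B \<le> e * t\<^sup>2" using \<delta>(1) by (rule mult_right_le_imp_le)
    also have "\<dots> \<le> \<epsilon> * t\<^sup>2" using e(3) by (intro mult_right_mono) auto
    finally have card_B: "card ?B \<le> \<epsilon> * t\<^sup>2" .
    have finB: "finite ?B"
    proof (rule finite_subset)
      show "?B \<subseteq> P \<times> P" by (auto simp: bad_pairs_def)
      show "finite (P \<times> P)" using finite_elements[OF fin part] by simp
    qed
    \<comment> \<open>An unordered pair is excluded as soon as one of its two orders is bad, so
      outside \<open>\<Sigma>\<close> both orders are good.\<close>
    define \<Sigma> where "\<Sigma> = (\<lambda>(A, B). {A, B}) ` {(A, B) \<in> ?B. A \<noteq> B}"
    have "card \<Sigma> \<le> card {(A, B) \<in> ?B. A \<noteq> B}"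
      unfolding \<Sigma>_def using finB by (intro card_image_le) (auto intro: finite_subset)
    also have "\<dots> \<le> card ?B" using finB by (intro card_mono) auto
    finally have card_\<Sigma>: "real (card \<Sigma>) \<le> \<epsilon> * real (card P) ^ 2"
      using card_B by (simp add: t_def)
    have \<Sigma>: "\<Sigma> \<subseteq> [P]\<^bsup>2\<^esup>"
    proof
      fix s assume "s \<in> \<Sigma>"
      then obtain p where "p \<in> {(A, B) \<in> ?B. A \<noteq> B}" "s = (\<lambda>(A, B). {A, B}) p"
        unfolding \<Sigma>_def by (elim imageE)
      then show "s \<in> [P]\<^bsup>2\<^esup>" by (cases p) (simp add: bad_pairs_def nsets_def)
    qed
    have good: "card (far_in V F' r A B) \<le> \<delta> * card A * (card B)\<^sup>2"
      if "A \<in> P" "B \<in> P" "A \<noteq> B" "{A, B} \<notin> \<Sigma>" for A B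
    proof (rule ccontr)
      assume "\<not> ?thesis"
      with that have "(A, B) \<in> {(A, B) \<in> ?B. A \<noteq> B}" by (simp add: bad_pairs_def)
      then have "{A, B} \<in> \<Sigma>" unfolding \<Sigma>_def by (rule rev_image_eqI) simp
      with that(4) show False ..
    qed
    have lower: "n / (2 * t) \<le> card A" if "A \<in> P" for A
      using equipartition_card_bounds(1)[OF P(1) fin that size(2)] pos
      by (simp add: n_def t_def field_simps)
    have r: "r * card V \<le> \<delta> * card A" if "A \<in> P" for A
    proof -
      have "r * card V = (2 * \<theta>) * (n / (2 * t))" using pos by (simp add: r_def n_def)
      also have "\<dots> \<le> \<delta> * card A" using \<theta> \<delta> pos lower[OF that] by (intro mult_mono) auto
      finally show ?thesis .
    qed
    have sub: "A \<subseteq> V" if "A \<in> P" for A using partition_onD1[OF part] that by auto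
    have ne: "A \<noteq> {}" if "A \<in> P" for A using partition_onD3[OF part] that by auto
    have disj: "A \<inter> B = {}" if "A \<in> P" "B \<in> P" "A \<noteq> B" for A B
      using pairwiseD[OF partition_onD2[OF part] that] by (simp add: disjnt_def)
    have disc: "vdisc3 \<epsilon> X Y Z (F \<inter> K3 X Y Z)"
      if P': "X \<in> P" "Y \<in> P" "Z \<in> P" and dist: "X \<noteq> Y" "Y \<noteq> Z" "X \<noteq> Z"
        and nS: "{X, Y} \<notin> \<Sigma>" "{Y, Z} \<notin> \<Sigma>" "{X, Z} \<notin> \<Sigma>" for X Y Z
    proof (rule vdisc3_perturb)
      show "vdisc3 (6 * \<delta>) X Y Z (F' \<inter> K3 X Y Z)"
      proof (rule vdisc3_of_links[OF fin sub sub sub disj disj disj ne ne ne _ r r r good good good])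
        show "{Y, X} \<notin> \<Sigma>" "{Z, Y} \<notin> \<Sigma>" using nS by (simp_all add: insert_commute)
      qed (use P' dist nS \<delta> in auto)
      have "n / (2 * w) \<le> card A" if "A \<in> P" for A
      proof -
        have "n / (2 * w) \<le> n / (2 * t)"
          using P(3) pos w by (intro divide_left_mono) (auto simp: t_def w_def)
        with lower[OF that] show ?thesis by linarith
      qed
      then have "n / (2 * w) * (n / (2 * w)) * (n / (2 * w))
          \<le> real (card X) * real (card Y) * real (card Z)"
        using P' pos w by (intro mult_mono) auto
      then have "e / 4 * (n ^ 3 / (8 * w ^ 3))
          \<le> e / 4 * (real (card X) * real (card Y) * real (card Z))"
        using e(1) by (intro mult_left_mono) (auto simp: power3_eq_cube)
      moreover have "\<alpha> * n ^ 3 = e / 4 * (n ^ 3 / (8 * w ^ 3))"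
        by (simp add: \<alpha>_def)
      ultimately show "card (sym_diff F F') \<le> e / 4 * (card X * card Y * card Z)"
        using near by (simp add: delta_close_def n_def)
    qed (use finF ne P' e in \<open>auto simp: \<delta>_def\<close>)
    show "\<exists>P \<Sigma>. equipartition V P \<and> t0 \<le> card P \<and> card P \<le> T \<and>
              \<Sigma> \<subseteq> [P]\<^bsup>2\<^esup> \<and> real (card \<Sigma>) \<le> \<epsilon> * real (card P) ^ 2 \<and>
              (\<forall>X \<in> P. \<forall>Y \<in> P. \<forall>Z \<in> P.
                 X \<noteq> Y \<and> Y \<noteq> Z \<and> X \<noteq> Z \<and> {X, Y} \<notin> \<Sigma> \<and> {Y, Z} \<notin> \<Sigma> \<and> {X, Z} \<notin> \<Sigma> \<longrightarrow>
                 vdisc3 \<epsilon> X Y Z (F \<inter> K3 X Y Z))"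
      by (rule exI[of _ P], rule exI[of _ \<Sigma>]) (use P(1-3) \<Sigma> card_\<Sigma> disc in simp)
  qed
qed

end
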